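(* Let $(N,\xi)$ be a closed connected co-oriented contact manifold with global contact form $\alpha$, $\mathcal{G}=\mathrm{Cont}_0(N,\xi)$, and let $\mathcal{R}=\{\phi_R^t\}_{t\in\mathbb{R}}$ be the Reeb flow of $\alpha$. For each $\psi\in\mathcal{G}$, $$\tfrac12|\psi|^{\mathrm{osc}}_\alpha=d_\alpha(\psi,\mathcal{R})=\inf_{t\in\mathbb{R}}d_\alpha(\psi,\phi_R^t).$$
   Context: $\mathcal{G}=\mathrm{Cont}_0(N,\xi)$ is the group of diffeomorphisms of $N$ preserving $\xi$ and its co-orientation that are isotopic to the identity through such diffeomorphisms. For a smooth isotopy $\{\psi_t\}_{t\in[0,1]}$ in $\mathcal{G}$, $\psi_0=1$, generated by $Y_t$ (i.e. $\frac{d}{dt}\psi_t=Y_t\circ\psi_t$), the contact Hamiltonian is $H_t=\alpha(Y_t)$. Over all such isotopies with $\psi_1=\psi$, define $|\psi|_\alpha=\inf\int_0^1\max_N|H_t|\,dt$ and $|\psi|^{\mathrm{osc}}_\alpha=\inf\int_0^1(\max_NH_t-\min_NH_t)\,dt$. The metric is $d_\alpha(\phi,\psi)=|\psi\phi^{-1}|_\alpha$. The Reeb field $R$ is defined by $\alpha(R)=1$, $\iota_Rd\alpha=0$, and $\phi_R^t$ is its flow. *)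

theory Defs
  imports "HOL-Analysis.Analysis"
begin

section \<open>Smooth functions between normed spaces\<close>

text \<open>
  The predicate \<open>Ck_on k W f\<close> is intended for open \<open>W\<close> in a finite-dimensional space. On an arbitrary
  set, such as \<open>[0,1]\<close> times an open set, a function is smooth if it extends smoothly to a
  neighbourhood of each point of the set.
\<close>

primrec Ck_on ::
  "nat \<Rightarrow> 'a::real_normed_vector set \<Rightarrow> ('a \<Rightarrow> 'b::real_normed_vector) \<Rightarrow> bool" where
  "Ck_on 0 W f \<longleftrightarrow> continuous_on W f"
| "Ck_on (Suc k) W f \<longleftrightarrow>
     (\<forall>x\<in>W. f differentiable (at x)) \<and> (\<forall>v. Ck_on k W (\<lambda>x. frechet_derivative f (at x) v))"

definition smooth_on :: "'a::real_normed_vector set \<Rightarrow> ('a \<Rightarrow> 'b::real_normed_vector) \<Rightarrow> bool" where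
  "smooth_on S f \<longleftrightarrow>
     (\<forall>x\<in>S. \<exists>W g. open W \<and> x \<in> W \<and> (\<forall>k. Ck_on k W g) \<and> (\<forall>y\<in>W \<inter> S. g y = f y))"

section \<open>Manifolds\<close>

text \<open>
  A manifold is a whole type \<open>'a\<close> with an atlas of charts into a Euclidean space \<open>'e\<close>. The atlas need
  not be maximal. A chart is a pair of an open domain and a coordinate map; the values of the map
  outside the domain are irrelevant.
\<close>

type_synonym ('a, 'e) chart = "'a set \<times> ('a \<Rightarrow> 'e)"

definition chart_image :: "('a, 'e) chart \<Rightarrow> 'e set" where
  "chart_image C = snd C ` fst C"

definition chart_inv :: "('a, 'e) chart \<Rightarrow> 'e \<Rightarrow> 'a" where
  "chart_inv C = inv_into (fst C) (snd C)"

definition smooth_atlas :: "('a::topological_space, 'e::euclidean_space) chart set \<Rightarrow> bool" where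
  "smooth_atlas A \<longleftrightarrow>
     (\<forall>C\<in>A. open (fst C) \<and> open (chart_image C) \<and>
            homeomorphism (fst C) (chart_image C) (snd C) (chart_inv C)) \<and>
     (\<Union>C\<in>A. fst C) = UNIV \<and>
     (\<forall>C\<in>A. \<forall>D\<in>A. smooth_on (snd C ` (fst C \<inter> fst D)) (snd D \<circ> chart_inv C))"

definition closed_connected_manifold ::
  "('a::{t2_space,second_countable_topology}, 'e::euclidean_space) chart set \<Rightarrow> bool" where
  "closed_connected_manifold A \<longleftrightarrow>
     smooth_atlas A \<and> compact (UNIV :: 'a set) \<and> connected (UNIV :: 'a set)"

definition chart_at :: "('a, 'e) chart set \<Rightarrow> 'a \<Rightarrow> ('a, 'e) chart" where
  "chart_at A p = (SOME C. C \<in> A \<and> p \<in> fst C)"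

definition smooth_map ::
  "('a::topological_space, 'e::euclidean_space) chart set \<Rightarrow> ('a \<Rightarrow> 'a) \<Rightarrow> bool" where
  "smooth_map A f \<longleftrightarrow>
     continuous_on UNIV f \<and>
     (\<forall>C\<in>A. \<forall>D\<in>A. smooth_on {y \<in> chart_image C. f (chart_inv C y) \<in> fst D}
                      (snd D \<circ> f \<circ> chart_inv C))"

definition diffeo ::
  "('a::topological_space, 'e::euclidean_space) chart set \<Rightarrow> ('a \<Rightarrow> 'a) \<Rightarrow> bool" where
  "diffeo A f \<longleftrightarrow> bij f \<and> smooth_map A f \<and> smooth_map A (inv f)"

text \<open>Joint smoothness of \<open>(t, p) \<mapsto> F t p\<close> on \<open>I \<times> N\<close>.\<close>

definition smooth_family ::
  "('a::topological_space, 'e::euclidean_space) chart set \<Rightarrow> real set \<Rightarrow> (real \<Rightarrow> 'a \<Rightarrow> 'a) \<Rightarrow> bool"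
where
  "smooth_family A I F \<longleftrightarrow>
     continuous_on (I \<times> UNIV) (\<lambda>(t, p). F t p) \<and>
     (\<forall>C\<in>A. \<forall>D\<in>A. smooth_on {(t, y). t \<in> I \<and> y \<in> chart_image C \<and> F t (chart_inv C y) \<in> fst D}
                      (\<lambda>(t, y). snd D (F t (chart_inv C y))))"

section \<open>Tangent vectors\<close>

text \<open>
  A tangent vector at \<open>p\<close> is the family of its coordinate vectors in all charts around \<open>p\<close>, related by
  the derivatives of the transition maps. The family is set to \<open>0\<close> at all other charts, so that equality
  of tangent vectors is equality of functions and the zero vector is the zero function.
\<close>

type_synonym ('a, 'e) tvec = "('a, 'e) chart \<Rightarrow> 'e"

definition tangent_space ::
  "('a, 'e::euclidean_space) chart set \<Rightarrow> 'a \<Rightarrow> ('a, 'e) tvec set" where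
  "tangent_space A p =
     {v. (\<forall>C\<in>A. \<forall>D\<in>A. p \<in> fst C \<longrightarrow> p \<in> fst D \<longrightarrow>
            v D = frechet_derivative (snd D \<circ> chart_inv C) (at (snd C p)) (v C)) \<and>
         (\<forall>C. \<not> (C \<in> A \<and> p \<in> fst C) \<longrightarrow> v C = 0)}"

text \<open>The tangent vector at \<open>p\<close> whose coordinates in the chart \<open>C\<close> are \<open>u\<close>.\<close>

definition tvec_of_coords ::
  "('a, 'e::euclidean_space) chart set \<Rightarrow> 'a \<Rightarrow> ('a, 'e) chart \<Rightarrow> 'e \<Rightarrow> ('a, 'e) tvec" where
  "tvec_of_coords A p C u =
     (\<lambda>D. if D \<in> A \<and> p \<in> fst D
          then frechet_derivative (snd D \<circ> chart_inv C) (at (snd C p)) u else 0)"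

definition pushforward ::
  "('a, 'e::euclidean_space) chart set \<Rightarrow> ('a \<Rightarrow> 'a) \<Rightarrow> 'a \<Rightarrow> ('a, 'e) tvec \<Rightarrow> ('a, 'e) tvec" where
  "pushforward A f p v =
     (let C = chart_at A p in
      (\<lambda>D. if D \<in> A \<and> f p \<in> fst D
           then frechet_derivative (snd D \<circ> f \<circ> chart_inv C) (at (snd C p)) (v C) else 0))"

definition smooth_vector_field ::
  "('a, 'e::euclidean_space) chart set \<Rightarrow> ('a \<Rightarrow> ('a, 'e) tvec) \<Rightarrow> bool" where
  "smooth_vector_field A X \<longleftrightarrow>
     (\<forall>p. X p \<in> tangent_space A p) \<and>
     (\<forall>C\<in>A. smooth_on (chart_image C) (\<lambda>y. X (chart_inv C y) C))"

text \<open>The curve \<open>c\<close>, defined on \<open>I\<close>, has velocity \<open>v\<close> at time \<open>t\<close> (one-sided at endpoints of \<open>I\<close>).\<close>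

definition has_velocity ::
  "('a, 'e::euclidean_space) chart set \<Rightarrow> real set \<Rightarrow> (real \<Rightarrow> 'a) \<Rightarrow> real \<Rightarrow> ('a, 'e) tvec \<Rightarrow> bool"
where
  "has_velocity A I c t v \<longleftrightarrow>
     v \<in> tangent_space A (c t) \<and>
     (\<forall>C\<in>A. c t \<in> fst C \<longrightarrow> ((\<lambda>s. snd C (c s)) has_vector_derivative v C) (at t within I))"

section \<open>Differential forms\<close>

type_synonym ('a, 'e) oneform = "'a \<Rightarrow> ('a, 'e) tvec \<Rightarrow> real"

definition smooth_one_form ::
  "('a, 'e::euclidean_space) chart set \<Rightarrow> ('a, 'e) oneform \<Rightarrow> bool" where
  "smooth_one_form A \<alpha> \<longleftrightarrow>
     (\<forall>p. \<forall>v\<in>tangent_space A p. \<forall>w\<in>tangent_space A p. \<forall>a b.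
        \<alpha> p (\<lambda>C. a *\<^sub>R v C + b *\<^sub>R w C) = a * \<alpha> p v + b * \<alpha> p w) \<and>
     (\<forall>C\<in>A. \<forall>u. smooth_on (chart_image C)
                   (\<lambda>y. \<alpha> (chart_inv C y) (tvec_of_coords A (chart_inv C y) C u)))"

text \<open>
  In local coordinates \<open>d\<alpha>(v, w) = D\<alpha>(v)(w) - D\<alpha>(w)(v)\<close>, evaluated in some chart around \<open>p\<close>; the
  value does not depend on the chart.
\<close>

definition ext_deriv ::
  "('a, 'e::euclidean_space) chart set \<Rightarrow> ('a, 'e) oneform \<Rightarrow>
   'a \<Rightarrow> ('a, 'e) tvec \<Rightarrow> ('a, 'e) tvec \<Rightarrow> real" where
  "ext_deriv A \<alpha> p v w =
     (let C = chart_at A p;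
          \<alpha>C = (\<lambda>u y. \<alpha> (chart_inv C y) (tvec_of_coords A (chart_inv C y) C u))
      in frechet_derivative (\<alpha>C (w C)) (at (snd C p)) (v C)
         - frechet_derivative (\<alpha>C (v C)) (at (snd C p)) (w C))"

section \<open>Contact structures\<close>

text \<open>
  A co-oriented hyperplane field is given by the hyperplanes \<open>\<xi> p\<close> together with the positive open
  half-spaces \<open>\<pi> p\<close> that they bound. The form \<open>\<alpha>\<close> is a contact form for it if it is a nowhere vanishing
  smooth one-form with kernel \<open>\<xi>\<close>, positive on \<open>\<pi>\<close>, such that \<open>d\<alpha>\<close> is nondegenerate on \<open>\<xi>\<close>. The dimension
  of the manifold is then odd, because \<open>\<xi> p\<close> is a symplectic vector space.
\<close>

definition contact_form_for ::
  "('a, 'e::euclidean_space) chart set \<Rightarrow> ('a \<Rightarrow> ('a, 'e) tvec set) \<Rightarrow>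
   ('a \<Rightarrow> ('a, 'e) tvec set) \<Rightarrow> ('a, 'e) oneform \<Rightarrow> bool" where
  "contact_form_for A \<xi> \<pi> \<alpha> \<longleftrightarrow>
     smooth_one_form A \<alpha> \<and>
     (\<forall>p. \<exists>v\<in>tangent_space A p. \<alpha> p v \<noteq> 0) \<and>
     (\<forall>p. \<xi> p = {v \<in> tangent_space A p. \<alpha> p v = 0}) \<and>
     (\<forall>p. \<pi> p = {v \<in> tangent_space A p. \<alpha> p v > 0}) \<and>
     (\<forall>p. \<forall>v\<in>\<xi> p. (\<forall>w\<in>\<xi> p. ext_deriv A \<alpha> p v w = 0) \<longrightarrow> v = (\<lambda>C. 0))"

definition Cont ::
  "('a::topological_space, 'e::euclidean_space) chart set \<Rightarrow> ('a \<Rightarrow> ('a, 'e) tvec set) \<Rightarrow>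
   ('a \<Rightarrow> ('a, 'e) tvec set) \<Rightarrow> ('a \<Rightarrow> 'a) set" where
  "Cont A \<xi> \<pi> = {f. diffeo A f \<and>
     (\<forall>p. pushforward A f p ` \<xi> p = \<xi> (f p)) \<and>
     (\<forall>p. pushforward A f p ` \<pi> p = \<pi> (f p))}"

definition smooth_isotopy ::
  "('a::topological_space, 'e::euclidean_space) chart set \<Rightarrow> ('a \<Rightarrow> 'a) set \<Rightarrow>
   (real \<Rightarrow> 'a \<Rightarrow> 'a) \<Rightarrow> bool" where
  "smooth_isotopy A S \<Psi> \<longleftrightarrow>
     smooth_family A {0..1} \<Psi> \<and> \<Psi> 0 = id \<and> (\<forall>t\<in>{0..1}. \<Psi> t \<in> S)"

definition Cont0 ::
  "('a::topological_space, 'e::euclidean_space) chart set \<Rightarrow> ('a \<Rightarrow> ('a, 'e) tvec set) \<Rightarrow>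
   ('a \<Rightarrow> ('a, 'e) tvec set) \<Rightarrow> ('a \<Rightarrow> 'a) set" where
  "Cont0 A \<xi> \<pi> = {\<Psi> 1 | \<Psi>. smooth_isotopy A (Cont A \<xi> \<pi>) \<Psi>}"

definition generates ::
  "('a, 'e::euclidean_space) chart set \<Rightarrow> (real \<Rightarrow> 'a \<Rightarrow> ('a, 'e) tvec) \<Rightarrow>
   (real \<Rightarrow> 'a \<Rightarrow> 'a) \<Rightarrow> bool" where
  "generates A Y \<Psi> \<longleftrightarrow>
     (\<forall>t\<in>{0..1}. \<forall>p. has_velocity A {0..1} (\<lambda>s. \<Psi> s p) t (Y t (\<Psi> t p)))"

definition reeb_field ::
  "('a, 'e::euclidean_space) chart set \<Rightarrow> ('a, 'e) oneform \<Rightarrow> ('a \<Rightarrow> ('a, 'e) tvec) \<Rightarrow> bool" where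
  "reeb_field A \<alpha> R \<longleftrightarrow>
     smooth_vector_field A R \<and>
     (\<forall>p. \<alpha> p (R p) = 1) \<and>
     (\<forall>p. \<forall>v\<in>tangent_space A p. ext_deriv A \<alpha> p (R p) v = 0)"

text \<open>The global flow of a vector field: the smooth action of the reals that it generates.\<close>

definition flow_of ::
  "('a::topological_space, 'e::euclidean_space) chart set \<Rightarrow> ('a \<Rightarrow> ('a, 'e) tvec) \<Rightarrow>
   (real \<Rightarrow> 'a \<Rightarrow> 'a) \<Rightarrow> bool" where
  "flow_of A X \<phi> \<longleftrightarrow>
     smooth_family A UNIV \<phi> \<and> \<phi> 0 = id \<and> (\<forall>s t. \<phi> (s + t) = \<phi> s \<circ> \<phi> t) \<and>
     (\<forall>t p. has_velocity A UNIV (\<lambda>s. \<phi> s p) t (X (\<phi> t p)))"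

section \<open>Norms on the contactomorphism group\<close>

text \<open>
  Here \<open>\<alpha> x (Y t x)\<close> is the contact Hamiltonian \<open>H t x\<close>. It is continuous in \<open>(t, x)\<close> on \<open>[0,1] \<times> N\<close>, and
  \<open>N\<close> is compact and nonempty, so the suprema and infima over \<open>x\<close> are maxima and minima, and the
  integrands are continuous in \<open>t\<close>.
\<close>

definition contact_norm ::
  "('a::topological_space, 'e::euclidean_space) chart set \<Rightarrow> ('a \<Rightarrow> ('a, 'e) tvec set) \<Rightarrow>
   ('a \<Rightarrow> ('a, 'e) tvec set) \<Rightarrow> ('a, 'e) oneform \<Rightarrow> ('a \<Rightarrow> 'a) \<Rightarrow> real" where
  "contact_norm A \<xi> \<pi> \<alpha> \<psi> =
     Inf {integral {0..1} (\<lambda>t. SUP x. \<bar>\<alpha> x (Y t x)\<bar>) | \<Psi> Y.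
            smooth_isotopy A (Cont0 A \<xi> \<pi>) \<Psi> \<and> generates A Y \<Psi> \<and> \<Psi> 1 = \<psi>}"

definition contact_osc_norm ::
  "('a::topological_space, 'e::euclidean_space) chart set \<Rightarrow> ('a \<Rightarrow> ('a, 'e) tvec set) \<Rightarrow>
   ('a \<Rightarrow> ('a, 'e) tvec set) \<Rightarrow> ('a, 'e) oneform \<Rightarrow> ('a \<Rightarrow> 'a) \<Rightarrow> real" where
  "contact_osc_norm A \<xi> \<pi> \<alpha> \<psi> =
     Inf {integral {0..1} (\<lambda>t. (SUP x. \<alpha> x (Y t x)) - (INF x. \<alpha> x (Y t x))) | \<Psi> Y.
            smooth_isotopy A (Cont0 A \<xi> \<pi>) \<Psi> \<and> generates A Y \<Psi> \<and> \<Psi> 1 = \<psi>}"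

definition contact_dist ::
  "('a::topological_space, 'e::euclidean_space) chart set \<Rightarrow> ('a \<Rightarrow> ('a, 'e) tvec set) \<Rightarrow>
   ('a \<Rightarrow> ('a, 'e) tvec set) \<Rightarrow> ('a, 'e) oneform \<Rightarrow> ('a \<Rightarrow> 'a) \<Rightarrow> ('a \<Rightarrow> 'a) \<Rightarrow> real" where
  "contact_dist A \<xi> \<pi> \<alpha> \<phi> \<psi> = contact_norm A \<xi> \<pi> \<alpha> (\<psi> \<circ> inv \<phi>)"

definition contact_dist_set ::
  "('a::topological_space, 'e::euclidean_space) chart set \<Rightarrow> ('a \<Rightarrow> ('a, 'e) tvec set) \<Rightarrow>
   ('a \<Rightarrow> ('a, 'e) tvec set) \<Rightarrow> ('a, 'e) oneform \<Rightarrow> ('a \<Rightarrow> 'a) \<Rightarrow> ('a \<Rightarrow> 'a) set \<Rightarrow> real" where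
  "contact_dist_set A \<xi> \<pi> \<alpha> \<psi> S = (INF \<rho>\<in>S. contact_dist A \<xi> \<pi> \<alpha> \<psi> \<rho>)"

end

(* If Psi_t is an isotopy with contact Hamiltonian H_t and a is a function with a(0) = 0, then
   phi^{a(t)} Psi_t has contact Hamiltonian a'(t) + H_t(phi^{-a(t)} x), since the Reeb flow phi
   preserves alpha. Taking a' = -(max H_t + min H_t)/2 turns the oscillation norm into twice the max
   norm at the price of moving the endpoint along the Reeb flow; this a is only C^1, so a' is replaced
   by a polynomial approximation. Conversely a(t) = -s t removes an endpoint factor phi^s without
   changing the oscillation. Both norms have to be compared at inverses, and Psi_{1-t} Psi_1^{-1} is
   an isotopy to the inverse with Hamiltonian -H_{1-t}. *)

theory Submission
  imports Defs
begin

section \<open>Calculus of smooth functions\<close>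

text \<open>The distance from \<psi> to a Reeb map is the norm of
  \<open>\<phi> t \<circ> inv \<psi>\<close>; this is the source of the inverses, and it puts the
  Reeb factor on the left, where it only permutes the values of the Hamiltonian at each time and
  adds a constant. The factor 1/2 compares the length of an interval with the largest absolute value
  on it once its midpoint is at 0. Most of the work is the calculus behind these formulas. A smooth
  family over [0,1] is only known to extend locally to open sets of time and space, so velocities,
  pushforwards and continuity are all read off from the derivative of such an extension: the
  direction (1, 0) gives the velocity, (0, u) the pushforward. Invariance of \<alpha> under the Reeb
  flow rests on the symmetry of the second derivative in these two directions. The extrema of the
  Hamiltonian depend continuously on t because the Hamiltonian is continuous along the moving points
  of the isotopy and N is compact; this is what makes polynomial approximation available.\<close>

lemma Ck_on_cong:
  assumes "open W" "Ck_on k W f" "\<And>x. x \<in> W \<Longrightarrow> f x = g x"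
  shows "Ck_on k W g"
  using assms(2,3)
proof (induction k arbitrary: f g)
  case 0
  then show ?case using continuous_on_cong[of W W f g] by simp
next
  case (Suc k)
  have d: "(g has_derivative frechet_derivative f (at x)) (at x)" if "x \<in> W" for x
    using has_derivative_transform_within_open[of f _ x UNIV W g] Suc.prems that assms(1)
    by (auto simp: frechet_derivative_works)
  have "Ck_on k W (\<lambda>x. frechet_derivative g (at x) v)" for v
    by (rule Suc.IH[of "\<lambda>x. frechet_derivative f (at x) v"])
      (use Suc.prems frechet_derivative_at[OF d] in auto)
  then show ?case using d by (auto simp: differentiable_def)
qed

lemma Ck_on_subset:
  assumes "Ck_on k W f" "V \<subseteq> W"
  shows "Ck_on k V f"
  using assms by (induction k arbitrary: f) (auto intro: continuous_on_subset)

lemma Ck_on_SucD: "Ck_on (Suc k) W f \<Longrightarrow> Ck_on k W f"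
proof (induction k arbitrary: f)
  case 0
  then show ?case
    by (auto intro!: continuous_at_imp_continuous_on differentiable_imp_continuous_within)
next
  case (Suc k)
  then show ?case by (metis Ck_on.simps(2))
qed

lemma Ck_on_differentiable:
  "Ck_on (Suc k) W f \<Longrightarrow> x \<in> W \<Longrightarrow> (f has_derivative frechet_derivative f (at x)) (at x)"
  by (auto simp: frechet_derivative_works)

text \<open>Lets the closure properties below supply an explicit formula for the derivative where
  the definition has \<open>frechet_derivative\<close>. Uniqueness of derivatives identifies the
  two, and openness of W carries this to higher orders.\<close>

lemma Ck_on_SucI:
  assumes "open W" "\<And>x. x \<in> W \<Longrightarrow> (f has_derivative f' x) (at x)"
    and "\<And>v. Ck_on k W (\<lambda>x. f' x v)"
  shows "Ck_on (Suc k) W f"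
proof -
  have "Ck_on k W (\<lambda>x. frechet_derivative f (at x) v)" for v
    by (rule Ck_on_cong[OF assms(1) assms(3)[of v]]) (simp add: frechet_derivative_at[OF assms(2), symmetric])
  then show ?thesis using assms(2) by (auto simp: differentiable_def)
qed

lemma Ck_on_local:
  assumes "\<And>x. x \<in> S \<Longrightarrow> \<exists>U. open U \<and> x \<in> U \<and> Ck_on k U f"
  shows "Ck_on k S f"
  using assms
proof (induction k arbitrary: f)
  case 0
  show ?case unfolding Ck_on.simps
  proof (intro continuous_at_imp_continuous_on ballI)
    fix x assume "x \<in> S"
    then obtain U where "open U" "x \<in> U" "continuous_on U f" using 0 by auto
    then show "isCont f x" by (simp add: continuous_on_eq_continuous_at)
  qed
next
  case (Suc k)
  have "Ck_on k S (\<lambda>x. frechet_derivative f (at x) v)" for v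
    by (rule Suc.IH) (use Suc.prems in fastforce)
  then show ?case using Suc.prems by fastforce
qed

lemma Ck_on_const: "Ck_on k W (\<lambda>x. c)"
  by (induction k arbitrary: c) auto

lemma Ck_on_bounded_linear:
  assumes "bounded_linear L" "open W" "Ck_on k W f"
  shows "Ck_on k W (\<lambda>x. L (f x))"
  using assms(3)
proof (induction k arbitrary: f)
  case 0
  then show ?case by (auto intro: bounded_linear.continuous_on[OF assms(1)])
next
  case (Suc k)
  show ?case
  proof (rule Ck_on_SucI[OF assms(2)])
    show "((\<lambda>x. L (f x)) has_derivative (\<lambda>v. L (frechet_derivative f (at x) v))) (at x)"
      if "x \<in> W" for x
      by (intro bounded_linear.has_derivative[OF assms(1)] Ck_on_differentiable[OF Suc.prems that])
  qed (use Suc in auto)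
qed

lemma Ck_on_add:
  assumes "open W" "Ck_on k W f" "Ck_on k W g"
  shows "Ck_on k W (\<lambda>x. f x + g x)"
  using assms(2,3)
proof (induction k arbitrary: f g)
  case 0
  then show ?case by (auto intro: continuous_intros)
next
  case (Suc k)
  show ?case
  proof (rule Ck_on_SucI[OF assms(1)])
    show "((\<lambda>x. f x + g x) has_derivative
        (\<lambda>v. frechet_derivative f (at x) v + frechet_derivative g (at x) v)) (at x)" if "x \<in> W" for x
      by (intro has_derivative_add Ck_on_differentiable[OF Suc.prems(1) that]
          Ck_on_differentiable[OF Suc.prems(2) that])
  qed (use Suc in auto)
qed

lemma Ck_on_sum:
  assumes "open W" "\<And>i. i \<in> I \<Longrightarrow> Ck_on k W (f i)"
  shows "Ck_on k W (\<lambda>x. \<Sum>i\<in>I. f i x)"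
  using assms(2)
  by (induction I rule: infinite_finite_induct) (auto intro: Ck_on_add[OF assms(1)] Ck_on_const)

lemma Ck_on_bounded_bilinear:
  assumes "bounded_bilinear h" "open W" "Ck_on k W f" "Ck_on k W g"
  shows "Ck_on k W (\<lambda>x. h (f x) (g x))"
  using assms(3,4)
proof (induction k arbitrary: f g)
  case 0
  then show ?case by (auto intro: bounded_bilinear.continuous_on[OF assms(1)])
next
  case (Suc k)
  show ?case
  proof (rule Ck_on_SucI[OF assms(2)])
    show "((\<lambda>x. h (f x) (g x)) has_derivative
        (\<lambda>v. h (f x) (frechet_derivative g (at x) v) + h (frechet_derivative f (at x) v) (g x))) (at x)"
      if "x \<in> W" for x
      by (intro bounded_bilinear.FDERIV[OF assms(1)] Ck_on_differentiable[OF Suc.prems(1) that]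
          Ck_on_differentiable[OF Suc.prems(2) that])
    show "Ck_on k W (\<lambda>x. h (f x) (frechet_derivative g (at x) v) +
        h (frechet_derivative f (at x) v) (g x))" for v
      by (intro Ck_on_add[OF assms(2)] Suc.IH Ck_on_SucD[OF Suc.prems(1)] Ck_on_SucD[OF Suc.prems(2)])
        (use Suc.prems in auto)
  qed
qed

lemma Ck_on_id: "Ck_on k W (\<lambda>x. x)"
  by (cases k) (auto intro: Ck_on_const)

lemma Ck_on_Pair:
  assumes "open W" "Ck_on k W f" "Ck_on k W g"
  shows "Ck_on k W (\<lambda>x. (f x, g x))"
proof -
  have "Ck_on k W (\<lambda>x. (f x, 0) + (0, g x))"
    using Ck_on_bounded_linear[of "\<lambda>y. (y, 0)", OF _ assms(1,2)]
      Ck_on_bounded_linear[of "\<lambda>y. (0, y)", OF _ assms(1,3)]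
    by (intro Ck_on_add[OF assms(1)]) (simp_all add: bounded_linear_Pair)
  then show ?thesis by simp
qed

text \<open>In the chain rule the derivative of g is applied to a direction that varies with x,
  whereas \<open>Ck_on\<close> differentiates in fixed directions. Expanding that direction in the
  basis of the intermediate space leaves a finite sum of products to which the induction hypothesis
  applies.\<close>

lemma Ck_on_compose:
  fixes f :: "'a::real_normed_vector \<Rightarrow> 'b::euclidean_space"
  assumes "open W" "open V" "f ` W \<subseteq> V" "Ck_on k W f" "Ck_on k V g"
  shows "Ck_on k W (\<lambda>x. g (f x))"
  using assms(4,5)
proof (induction k arbitrary: g)
  case 0
  then show ?case using assms(3) by (auto intro: continuous_on_compose2)
next
  case (Suc k)
  have f: "Ck_on k W f" by (rule Ck_on_SucD[OF Suc.prems(1)])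
  show ?case
  proof (rule Ck_on_SucI[OF assms(1)])
    fix x assume x: "x \<in> W"
    then have g: "(g has_derivative frechet_derivative g (at (f x))) (at (f x))"
      using assms(3) by (intro Ck_on_differentiable[OF Suc.prems(2)]) auto
    interpret bounded_linear "frechet_derivative g (at (f x))"
      by (rule has_derivative_bounded_linear[OF g])
    have rep: "frechet_derivative g (at (f x)) w =
        (\<Sum>i\<in>Basis. (w \<bullet> i) *\<^sub>R frechet_derivative g (at (f x)) i)" for w
    proof -
      have "frechet_derivative g (at (f x)) w =
          frechet_derivative g (at (f x)) (\<Sum>i\<in>Basis. (w \<bullet> i) *\<^sub>R i)"
        by (simp add: euclidean_representation)
      then show ?thesis by (simp only: sum scaleR)
    qed
    show "((\<lambda>x. g (f x)) has_derivative (\<lambda>v. \<Sum>i\<in>Basis.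
        (frechet_derivative f (at x) v \<bullet> i) *\<^sub>R frechet_derivative g (at (f x)) i)) (at x)"
      using has_derivative_compose[OF Ck_on_differentiable[OF Suc.prems(1) x] g]
      by (simp only: rep[symmetric])
  next
    fix v
    have "Ck_on k W (\<lambda>x. frechet_derivative g (at (f x)) i)" for i
      using Suc.IH[OF f, of "\<lambda>y. frechet_derivative g (at y) i"] Suc.prems(2) by simp
    then show "Ck_on k W (\<lambda>x. \<Sum>i\<in>Basis.
        (frechet_derivative f (at x) v \<bullet> i) *\<^sub>R frechet_derivative g (at (f x)) i)"
      by (intro Ck_on_sum[OF assms(1)] Ck_on_bounded_bilinear[OF bounded_bilinear_scaleR assms(1)]
          Ck_on_bounded_linear[OF bounded_linear_inner_left assms(1)])
        (use Suc.prems(1) in auto)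
  qed
qed

text \<open>On an open set the local extensions coincide with f near each point, so f inherits their
  derivatives.\<close>

lemma smooth_on_open_iff: "open S \<Longrightarrow> smooth_on S f \<longleftrightarrow> (\<forall>k. Ck_on k S f)"
proof safe
  fix k assume "smooth_on S f" "open S"
  show "Ck_on k S f"
  proof (rule Ck_on_local)
    fix x assume "x \<in> S"
    then obtain W g where "open W" "x \<in> W" "Ck_on k W g" "\<forall>y\<in>W \<inter> S. g y = f y"
      using \<open>smooth_on S f\<close> unfolding smooth_on_def by blast
    then show "\<exists>U. open U \<and> x \<in> U \<and> Ck_on k U f"
      using \<open>open S\<close> \<open>x \<in> S\<close>
      by (intro exI[of _ "W \<inter> S"]) (auto intro: Ck_on_cong[of _ k g] Ck_on_subset)
  qed
qed (auto simp: smooth_on_def)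

text \<open>The double difference \<open>f (s, s) - f (s, 0) - f (0, s) + f (0, 0)\<close> is computed by the mean value
  theorem in both orders.\<close>

lemma double_difference_mvt:
  fixes f :: "real \<Rightarrow> real \<Rightarrow> real"
  assumes s: "0 < s"
    and f1: "\<And>x y. 0 \<le> x \<Longrightarrow> x \<le> s \<Longrightarrow> 0 \<le> y \<Longrightarrow> y \<le> s \<Longrightarrow>
       ((\<lambda>x. f x y) has_real_derivative f1 x y) (at x)"
    and f12: "\<And>x y. 0 \<le> x \<Longrightarrow> x \<le> s \<Longrightarrow> 0 \<le> y \<Longrightarrow> y \<le> s \<Longrightarrow>
       ((\<lambda>y. f1 x y) has_real_derivative f12 x y) (at y)"
  shows "\<exists>x y. 0 \<le> x \<and> x \<le> s \<and> 0 \<le> y \<and> y \<le> s \<and>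
     f s s - f s 0 - f 0 s + f 0 0 = s * s * f12 x y"
proof -
  have "\<exists>x>0. x < s \<and> (f s s - f s 0) - (f 0 s - f 0 0) = (s - 0) * (f1 x s - f1 x 0)"
    by (rule MVT2[of 0 s "\<lambda>x. f x s - f x 0"]) (use s in \<open>auto intro!: DERIV_diff f1\<close>)
  then obtain x where x: "0 < x" "x < s"
    "(f s s - f s 0) - (f 0 s - f 0 0) = s * (f1 x s - f1 x 0)" by auto
  have "\<exists>y>0. y < s \<and> f1 x s - f1 x 0 = (s - 0) * f12 x y"
    by (rule MVT2[of 0 s "\<lambda>y. f1 x y"]) (use s x in \<open>auto intro!: f12\<close>)
  then obtain y where "0 < y" "y < s" "f1 x s - f1 x 0 = s * f12 x y" by auto
  with x show ?thesis by (intro exI[of _ x] exI[of _ y]) (auto simp: algebra_simps)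
qed

text \<open>Along x + a v + b w, both mixed derivatives equal the same double difference divided by
  s^2, each at some point of a small square. Their continuity at x makes their values there differ
  by less than any e.\<close>

lemma second_derivative_symmetric_real:
  fixes f :: "'a::real_normed_vector \<Rightarrow> real"
  assumes W: "open W" "x \<in> W" and f: "Ck_on 2 W f"
  shows "frechet_derivative (\<lambda>y. frechet_derivative f (at y) v) (at x) w =
         frechet_derivative (\<lambda>y. frechet_derivative f (at y) w) (at x) v"
proof -
  define D where "D v y = frechet_derivative f (at y) v" for v y
  define D2 where "D2 v w y = frechet_derivative (D v) (at y) w" for v w y
  have f': "(f has_derivative (\<lambda>v. D v y)) (at y)" if "y \<in> W" for y
    using f that unfolding D_def by (auto simp: numeral_2_eq_2 frechet_derivative_works)
  have D': "(D v has_derivative (\<lambda>w. D2 v w y)) (at y)" if "y \<in> W" for y v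
    using f that unfolding D2_def D_def by (auto simp: numeral_2_eq_2 frechet_derivative_works)
  have cont: "isCont (D2 v w) x" for v w
    using f W unfolding D2_def D_def by (auto simp: numeral_2_eq_2 continuous_on_eq_continuous_at)
  define P where "P = (\<lambda>(a, b). x + a *\<^sub>R v + b *\<^sub>R w)"
  have P: "isCont P (0, 0)" unfolding P_def case_prod_unfold by (intro continuous_intros)
  have P0: "P (0, 0) = x" by (simp add: P_def)
  have "\<bar>D2 v w x - D2 w v x\<bar> < e" if "0 < e" for e
  proof -
    have "\<forall>\<^sub>F z in nhds (0, 0). P z \<in> W \<and> \<bar>D2 v w (P z) - D2 v w x\<bar> < e / 2 \<and>
        \<bar>D2 w v (P z) - D2 w v x\<bar> < e / 2"
    proof (intro eventually_conj)
      have L: "filterlim P (nhds x) (nhds (0, 0))"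
        using P tendsto_at_iff_tendsto_nhds[of P "(0, 0)"] by (simp add: isCont_def P0)
      show "\<forall>\<^sub>F z in nhds (0, 0). P z \<in> W"
        using topological_tendstoD[OF L W] .
      have "filterlim (\<lambda>z. D2 v w (P z)) (nhds (D2 v w x)) (nhds (0, 0))" for v w
        by (rule filterlim_compose[OF _ L])
          (use cont[of v w] in \<open>simp add: isCont_def tendsto_at_iff_tendsto_nhds\<close>)
      then show "\<forall>\<^sub>F z in nhds (0, 0). \<bar>D2 v w (P z) - D2 v w x\<bar> < e / 2"
        "\<forall>\<^sub>F z in nhds (0, 0). \<bar>D2 w v (P z) - D2 w v x\<bar> < e / 2"
        using that half_gt_zero[OF that] unfolding tendsto_iff dist_real_def by blast+
    qed
    then obtain d where d: "0 < d" and
      near: "\<And>z. dist z (0, 0) < d \<Longrightarrow> P z \<in> W \<and> \<bar>D2 v w (P z) - D2 v w x\<bar> < e / 2 \<and>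
        \<bar>D2 w v (P z) - D2 w v x\<bar> < e / 2"
      unfolding eventually_nhds_metric by blast
    \<comment> \<open>Points of the square with side s have norm at most 2 * d / 3, which is below
      d.\<close>
    define s where "s = d / 3"
    have s: "0 < s" using d by (simp add: s_def)
    have near': "P (a, b) \<in> W \<and> \<bar>D2 v w (P (a, b)) - D2 v w x\<bar> < e / 2 \<and>
        \<bar>D2 w v (P (a, b)) - D2 w v x\<bar> < e / 2" if "0 \<le> a" "a \<le> s" "0 \<le> b" "b \<le> s" for a b
    proof (rule near)
      have "norm (a, b) \<le> norm a + norm b" by (rule norm_Pair_le)
      also have "\<dots> < d" using that d by (simp add: s_def)
      finally show "dist (a, b) (0, 0) < d" by (simp add: dist_norm)
    qed
    have da: "((\<lambda>a. g (P (a, b))) has_real_derivative g' v) (at a)"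
      and db: "((\<lambda>b. g (P (a, b))) has_real_derivative g' w) (at b)"
      if g: "(g has_derivative g') (at (P (a, b)))" for g :: "'a \<Rightarrow> real" and g' a b
    proof -
      have "((\<lambda>a. P (a, b)) has_derivative (\<lambda>h. h *\<^sub>R v)) (at a)"
        "((\<lambda>b. P (a, b)) has_derivative (\<lambda>h. h *\<^sub>R w)) (at b)"
        unfolding P_def by (auto intro!: derivative_eq_intros)
      from this[THEN has_derivative_compose, OF g]
      show "((\<lambda>a. g (P (a, b))) has_real_derivative g' v) (at a)"
        "((\<lambda>b. g (P (a, b))) has_real_derivative g' w) (at b)"
        by (simp_all add: has_field_derivative_def linear_cmul[OF has_derivative_linear[OF g]]
            mult_commute_abs)
    qed
    let ?F = "\<lambda>a b. f (P (a, b))"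
    obtain a b where ab: "0 \<le> a" "a \<le> s" "0 \<le> b" "b \<le> s"
      "?F s s - ?F s 0 - ?F 0 s + ?F 0 0 = s * s * D2 v w (P (a, b))"
      using double_difference_mvt[OF s, of ?F "\<lambda>a b. D v (P (a, b))" "\<lambda>a b. D2 v w (P (a, b))"]
      using da[OF f'] db[OF D'] near' by blast
    obtain a' b' where ab': "0 \<le> a'" "a' \<le> s" "0 \<le> b'" "b' \<le> s"
      "?F s s - ?F 0 s - ?F s 0 + ?F 0 0 = s * s * D2 w v (P (b', a'))"
      using double_difference_mvt[OF s, of "\<lambda>b a. ?F a b" "\<lambda>b a. D w (P (a, b))"
          "\<lambda>b a. D2 w v (P (a, b))"]
      using db[OF f'] da[OF D'] near' by blast
    have "s * s * D2 v w (P (a, b)) = s * s * D2 w v (P (b', a'))"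
      using ab(5) ab'(5) by linarith
    then have "D2 v w (P (a, b)) = D2 w v (P (b', a'))" using s by simp
    with near'[OF ab(1-4)] near'[OF ab'(3,4,1,2)] show ?thesis by linarith
  qed
  \<comment> \<open>With the difference itself as e: were it positive, it would be less than
    itself.\<close>
  from this[of "\<bar>D2 v w x - D2 w v x\<bar>"] have "D2 v w x = D2 w v x" by auto
  then show ?thesis by (simp add: D2_def D_def[abs_def])
qed

lemma second_derivative_symmetric:
  fixes f :: "'a::real_normed_vector \<Rightarrow> 'b::euclidean_space"
  assumes W: "open W" "x \<in> W" and f: "Ck_on 2 W f"
  shows "frechet_derivative (\<lambda>y. frechet_derivative f (at y) v) (at x) w =
         frechet_derivative (\<lambda>y. frechet_derivative f (at y) w) (at x) v"
proof (rule euclidean_eqI)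
  fix i :: 'b assume "i \<in> Basis"
  define fi where "fi y = f y \<bullet> i" for y
  have fi: "Ck_on 2 W fi"
    unfolding fi_def by (rule Ck_on_bounded_linear[OF bounded_linear_inner_left W(1) f])
  have inner: "frechet_derivative (\<lambda>y. h y \<bullet> i) (at y) v = frechet_derivative h (at y) v \<bullet> i"
    if "Ck_on (Suc 0) W h" "y \<in> W" for h :: "'a \<Rightarrow> 'b" and y v
    by (simp add: frechet_derivative_at[OF has_derivative_inner_left[OF Ck_on_differentiable[OF that], of i], symmetric])
  have f1: "Ck_on (Suc 0) W f" by (rule Ck_on_SucD[OF f[unfolded numeral_2_eq_2]])
  have "frechet_derivative (\<lambda>y. frechet_derivative f (at y) v) (at x) w \<bullet> i =
      frechet_derivative (\<lambda>y. frechet_derivative fi (at y) v) (at x) w" for v w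
  proof -
    have g: "Ck_on (Suc 0) W (\<lambda>y. frechet_derivative f (at y) v)"
      using f by (auto simp: numeral_2_eq_2)
    have "frechet_derivative (\<lambda>y. frechet_derivative f (at y) v) (at x) w \<bullet> i =
        frechet_derivative (\<lambda>y. frechet_derivative f (at y) v \<bullet> i) (at x) w"
      using inner[OF g W(2)] by simp
    also have "frechet_derivative (\<lambda>y. frechet_derivative f (at y) v \<bullet> i) (at x) =
        frechet_derivative (\<lambda>y. frechet_derivative fi (at y) v) (at x)"
      using Ck_on_differentiable[OF Ck_on_bounded_linear[OF bounded_linear_inner_left W(1) g] W(2)]
      by (intro frechet_derivative_transform_within_open[OF _ W])
        (auto simp: fi_def[abs_def] inner[OF f1] differentiable_def)
    finally show ?thesis .
  qed
  then show "frechet_derivative (\<lambda>y. frechet_derivative f (at y) v) (at x) w \<bullet> i =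
      frechet_derivative (\<lambda>y. frechet_derivative f (at y) w) (at x) v \<bullet> i"
    using second_derivative_symmetric_real[OF W fi] by simp
qed

section \<open>Charts and coordinate representations\<close>

definition crep :: "('a, 'e) chart \<Rightarrow> ('a \<Rightarrow> 'a) \<Rightarrow> ('a, 'e) chart \<Rightarrow> 'e \<Rightarrow> 'e" where
  "crep C f D = snd D \<circ> f \<circ> chart_inv C"

text \<open>The Jacobian of f at p in the charts C and D. For f = id it is the derivative of a
  transition map, so compatibility of tangent vectors and functoriality of pushforwards both become
  instances of one chain rule.\<close>

definition dcrep ::
  "('a, 'e::real_normed_vector) chart \<Rightarrow> ('a \<Rightarrow> 'a) \<Rightarrow> ('a, 'e) chart \<Rightarrow> 'a \<Rightarrow> 'e \<Rightarrow> 'e" where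
  "dcrep C f D p = frechet_derivative (crep C f D) (at (snd C p))"

lemma chart_in_image: "p \<in> fst C \<Longrightarrow> snd C p \<in> chart_image C"
  by (simp add: chart_image_def)

lemma chart_inv_in: "y \<in> chart_image C \<Longrightarrow> chart_inv C y \<in> fst C"
  by (simp add: chart_image_def chart_inv_def inv_into_into)

lemma chart_inv_right: "y \<in> chart_image C \<Longrightarrow> snd C (chart_inv C y) = y"
  by (simp add: chart_image_def chart_inv_def f_inv_into_f)

locale atlas_manifold =
  fixes A :: "('a::topological_space, 'e::euclidean_space) chart set"
  assumes atlas: "smooth_atlas A"
begin

lemma chart_open: "C \<in> A \<Longrightarrow> open (fst C)"
  and chart_image_open: "C \<in> A \<Longrightarrow> open (chart_image C)"
  and chart_homeo: "C \<in> A \<Longrightarrow> homeomorphism (fst C) (chart_image C) (snd C) (chart_inv C)"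
  using atlas unfolding smooth_atlas_def by auto

lemma chart_inv_left: "C \<in> A \<Longrightarrow> p \<in> fst C \<Longrightarrow> chart_inv C (snd C p) = p"
  using chart_homeo homeomorphism_apply1 by metis

lemma chart_cont: "C \<in> A \<Longrightarrow> continuous_on (fst C) (snd C)"
  and chart_inv_cont: "C \<in> A \<Longrightarrow> continuous_on (chart_image C) (chart_inv C)"
  using chart_homeo unfolding homeomorphism_def by auto

lemma ex_chart: "\<exists>C\<in>A. p \<in> fst C"
proof -
  have "p \<in> (\<Union>C\<in>A. fst C)" using atlas unfolding smooth_atlas_def by auto
  then show ?thesis by auto
qed

lemma chart_at: "chart_at A p \<in> A" "p \<in> fst (chart_at A p)"
proof -
  have "chart_at A p \<in> A \<and> p \<in> fst (chart_at A p)"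
    unfolding chart_at_def by (rule someI_ex) (use ex_chart in blast)
  then show "chart_at A p \<in> A" "p \<in> fst (chart_at A p)" by auto
qed

section \<open>Smooth families and smooth maps\<close>

lemma smooth_familyI:
  assumes "continuous_on (I \<times> UNIV) (\<lambda>(t, p). F t p)"
    and "\<And>t p C D. \<lbrakk>t \<in> I; C \<in> A; p \<in> fst C; D \<in> A; F t p \<in> fst D\<rbrakk> \<Longrightarrow>
      \<exists>W g. open W \<and> (t, snd C p) \<in> W \<and> (\<forall>k. Ck_on k W g) \<and>
        (\<forall>s y. (s, y) \<in> W \<longrightarrow> s \<in> I \<longrightarrow> y \<in> chart_image C \<longrightarrow>
          g (s, y) = snd D (F s (chart_inv C y)))"
  shows "smooth_family A I F"
  unfolding smooth_family_def
proof (intro conjI assms(1) ballI)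
  fix C D assume CD: "C \<in> A" "D \<in> A"
  let ?S = "{(t, y). t \<in> I \<and> y \<in> chart_image C \<and> F t (chart_inv C y) \<in> fst D}"
  show "smooth_on ?S (\<lambda>(t, y). snd D (F t (chart_inv C y)))"
    unfolding smooth_on_def
  proof
    fix z assume z: "z \<in> ?S"
    obtain t y where [simp]: "z = (t, y)" by (cases z)
    have y: "snd C (chart_inv C y) = y" "chart_inv C y \<in> fst C"
      using z by (auto intro: chart_inv_right chart_inv_in)
    obtain W g where "open W" "(t, y) \<in> W" "\<forall>k. Ck_on k W g"
      "\<forall>s y. (s, y) \<in> W \<longrightarrow> s \<in> I \<longrightarrow> y \<in> chart_image C \<longrightarrow> g (s, y) = snd D (F s (chart_inv C y))"
      using assms(2)[of t C "chart_inv C y" D] z y CD by auto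
    then show "\<exists>W g. open W \<and> z \<in> W \<and> (\<forall>k. Ck_on k W g) \<and>
        (\<forall>y\<in>W \<inter> ?S. g y = (case y of (t, y) \<Rightarrow> snd D (F t (chart_inv C y))))"
      by (intro exI[of _ W] exI[of _ g]) auto
  qed
qed

text \<open>The extension g lives on an open set of time and space, so ordinary derivatives exist
  even at endpoints of I. By continuity of F the set W can be shrunk until every (s, y) in it with s
  in I meets the domain conditions, which spares side conditions in later uses.\<close>

lemma smooth_family_local_extension:
  assumes F: "smooth_family A I F" and t: "t \<in> I"
    and C: "C \<in> A" "p \<in> fst C" and D: "D \<in> A" "F t p \<in> fst D"
  obtains W g where "open W" "(t, snd C p) \<in> W" "\<And>k. Ck_on k W g"
    "\<And>s y. (s, y) \<in> W \<Longrightarrow> s \<in> I \<Longrightarrow>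
      y \<in> chart_image C \<and> F s (chart_inv C y) \<in> fst D \<and> g (s, y) = snd D (F s (chart_inv C y))"
proof -
  let ?S = "{(t, y). t \<in> I \<and> y \<in> chart_image C \<and> F t (chart_inv C y) \<in> fst D}"
  have S: "(t, snd C p) \<in> ?S" using t C D by (simp add: chart_in_image chart_inv_left)
  obtain W g where W: "open W" "(t, snd C p) \<in> W" "\<forall>k. Ck_on k W g"
    "\<forall>z\<in>W \<inter> ?S. g z = (case z of (t, y) \<Rightarrow> snd D (F t (chart_inv C y)))"
  proof -
    have "smooth_on ?S (\<lambda>(t, y). snd D (F t (chart_inv C y)))"
      using F C(1) D(1) unfolding smooth_family_def by blast
    from this[unfolded smooth_on_def, rule_format, OF S] show thesis using that by blast
  qed
  have "continuous_on (I \<times> chart_image C) (\<lambda>z. (\<lambda>(t, p). F t p) (fst z, chart_inv C (snd z)))"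
  proof (rule continuous_on_compose2[of "I \<times> UNIV" "\<lambda>(t, p). F t p"])
    show "continuous_on (I \<times> UNIV) (\<lambda>(t, p). F t p)" using F by (simp add: smooth_family_def)
    show "continuous_on (I \<times> chart_image C) (\<lambda>z. (fst z, chart_inv C (snd z)))"
      by (intro continuous_intros continuous_on_compose2[OF chart_inv_cont[OF C(1)]]) auto
  qed auto
  \<comment> \<open>Continuity gives only relative openness in
    \<open>I \<times> chart_image C\<close>; T is an open set of the whole space with that
    trace.\<close>
  then obtain T where T: "open T"
    "T \<inter> (I \<times> chart_image C) = (\<lambda>z. F (fst z) (chart_inv C (snd z))) -` fst D \<inter> (I \<times> chart_image C)"
    using chart_open[OF D(1)] unfolding continuous_on_open_invariant by force
  define W' where "W' = W \<inter> T \<inter> (UNIV \<times> chart_image C)"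
  show thesis
  proof
    show "open W'" unfolding W'_def
      using W(1) T(1) chart_image_open[OF C(1)] by (intro open_Int open_Times) auto
    have "(t, snd C p) \<in> T \<inter> (I \<times> chart_image C)" unfolding T(2) using S by auto
    then show "(t, snd C p) \<in> W'" unfolding W'_def using W(2) by auto
    show "Ck_on k W' g" for k using W(3) by (auto intro: Ck_on_subset simp: W'_def)
    fix s y assume *: "(s, y) \<in> W'" "s \<in> I"
    then have "(s, y) \<in> T \<inter> (I \<times> chart_image C)" by (auto simp: W'_def)
    then have "(s, y) \<in> ?S" unfolding T(2) by auto
    with * W(4) show "y \<in> chart_image C \<and> F s (chart_inv C y) \<in> fst D \<and>
        g (s, y) = snd D (F s (chart_inv C y))"
      by (auto simp: W'_def)
  qed
qed

lemma smooth_family_cont: "smooth_family A I F \<Longrightarrow> continuous_on (I \<times> UNIV) (\<lambda>(t, p). F t p)"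
  by (simp add: smooth_family_def)

lemma smooth_family_compose:
  assumes F: "smooth_family A I F" and G: "smooth_family A I G"
  shows "smooth_family A I (\<lambda>t. F t \<circ> G t)"
proof (rule smooth_familyI)
  have "continuous_on (I \<times> UNIV) (\<lambda>z. (\<lambda>(t, p). F t p) (fst z, (\<lambda>(t, p). G t p) z))"
    by (rule continuous_on_compose2[OF smooth_family_cont[OF F]])
      (auto intro!: continuous_intros smooth_family_cont[OF G])
  then show "continuous_on (I \<times> UNIV) (\<lambda>(t, p). (F t \<circ> G t) p)"
    by (simp add: case_prod_unfold)
next
  fix t p C D assume t: "t \<in> I" and C: "C \<in> A" "p \<in> fst C" and D: "D \<in> A" "(F t \<circ> G t) p \<in> fst D"
  obtain E where E: "E \<in> A" "G t p \<in> fst E" using ex_chart by blast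
  obtain W1 g1 where W1: "open W1" "(t, snd C p) \<in> W1" "\<And>k. Ck_on k W1 g1"
    "\<And>s y. (s, y) \<in> W1 \<Longrightarrow> s \<in> I \<Longrightarrow>
      y \<in> chart_image C \<and> G s (chart_inv C y) \<in> fst E \<and> g1 (s, y) = snd E (G s (chart_inv C y))"
    using smooth_family_local_extension[OF G t C E] by blast
  obtain W2 g2 where W2: "open W2" "(t, snd E (G t p)) \<in> W2" "\<And>k. Ck_on k W2 g2"
    "\<And>s y. (s, y) \<in> W2 \<Longrightarrow> s \<in> I \<Longrightarrow>
      y \<in> chart_image E \<and> F s (chart_inv E y) \<in> fst D \<and> g2 (s, y) = snd D (F s (chart_inv E y))"
    using smooth_family_local_extension[OF F t E D(1)] D(2) by auto
  \<comment> \<open>The composite extension is g2 after h. For times outside I nothing relates g1 to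
    W2, so the domain is cut down to the preimage of W2.\<close>
  define h where "h z = (fst z, g1 z)" for z
  have h: "Ck_on k W1 h" for k unfolding h_def
    by (intro Ck_on_Pair W1 Ck_on_bounded_linear[OF bounded_linear_fst] Ck_on_id)
  have "continuous_on W1 h" using h[of 0] by simp
  then have op: "open (W1 \<inter> h -` W2)" using W1(1) W2(1) by (metis continuous_on_open_vimage Int_commute)
  show "\<exists>W g. open W \<and> (t, snd C p) \<in> W \<and> (\<forall>k. Ck_on k W g) \<and>
        (\<forall>s y. (s, y) \<in> W \<longrightarrow> s \<in> I \<longrightarrow> y \<in> chart_image C \<longrightarrow>
          g (s, y) = snd D ((F s \<circ> G s) (chart_inv C y)))"
  proof (intro exI conjI allI impI)
    show "open (W1 \<inter> h -` W2)" by fact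
    show "(t, snd C p) \<in> W1 \<inter> h -` W2"
      using W1(2) W2(2) W1(4)[OF W1(2) t] C by (simp add: h_def chart_inv_left)
    show "Ck_on k (W1 \<inter> h -` W2) (\<lambda>z. g2 (h z))" for k
      by (rule Ck_on_compose[OF op W2(1) _ _ W2(3)]) (auto intro: Ck_on_subset[OF h])
    fix s y assume "(s, y) \<in> W1 \<inter> h -` W2" and s: "s \<in> I"
    then have 1: "(s, y) \<in> W1" and 2: "(s, g1 (s, y)) \<in> W2" by (auto simp: h_def)
    show "g2 (h (s, y)) = snd D ((F s \<circ> G s) (chart_inv C y))"
      using W1(4)[OF 1 s] W2(4)[OF 2 s] E(1) by (auto simp: h_def chart_inv_left)
  qed
qed

lemma smooth_family_reparam:
  assumes F: "smooth_family A J F" and a: "\<And>k. Ck_on k UNIV a" "a ` I \<subseteq> J"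
  shows "smooth_family A I (\<lambda>t. F (a t))"
proof (rule smooth_familyI)
  have "continuous_on UNIV a" using a(1)[of 0] by simp
  then have "continuous_on (I \<times> UNIV) (\<lambda>z. (\<lambda>(t, p). F t p) (a (fst z), snd z))"
    using a(2) by (intro continuous_on_compose2[OF smooth_family_cont[OF F]])
      (auto intro!: continuous_intros continuous_on_compose2[of UNIV a])
  then show "continuous_on (I \<times> UNIV) (\<lambda>(t, p). F (a t) p)"
    by (simp add: case_prod_unfold)
next
  fix t p C D assume t: "t \<in> I" and C: "C \<in> A" "p \<in> fst C" and D: "D \<in> A" "F (a t) p \<in> fst D"
  have "a t \<in> J" using t a(2) by auto
  then obtain W g where W: "open W" "(a t, snd C p) \<in> W" "\<And>k. Ck_on k W g"
    "\<And>s y. (s, y) \<in> W \<Longrightarrow> s \<in> J \<Longrightarrow>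
      y \<in> chart_image C \<and> F s (chart_inv C y) \<in> fst D \<and> g (s, y) = snd D (F s (chart_inv C y))"
    using smooth_family_local_extension[OF F _ C D] by blast
  define h :: "real \<times> 'e \<Rightarrow> real \<times> 'e" where "h z = (a (fst z), snd z)" for z
  have h: "Ck_on k UNIV h" for k
    unfolding h_def
    by (intro Ck_on_Pair Ck_on_compose[where f = fst and g = a and V = UNIV] a(1) open_UNIV
        Ck_on_bounded_linear[OF bounded_linear_fst] Ck_on_bounded_linear[OF bounded_linear_snd] Ck_on_id)
      auto
  have op: "open (h -` W)" using h[of 0] W(1) by (simp add: continuous_on_open_vimage)
  show "\<exists>W g. open W \<and> (t, snd C p) \<in> W \<and> (\<forall>k. Ck_on k W g) \<and>
        (\<forall>s y. (s, y) \<in> W \<longrightarrow> s \<in> I \<longrightarrow> y \<in> chart_image C \<longrightarrow>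
          g (s, y) = snd D (F (a s) (chart_inv C y)))"
  proof (intro exI conjI allI impI)
    show "open (h -` W)" by fact
    show "(t, snd C p) \<in> h -` W" using W(2) by (simp add: h_def)
    show "Ck_on k (h -` W) (\<lambda>z. g (h z))" for k
      by (rule Ck_on_compose[OF op W(1) _ _ W(3)]) (auto intro: Ck_on_subset[OF h])
    fix s y assume "(s, y) \<in> h -` W" and s: "s \<in> I"
    then have "(a s, y) \<in> W" "a s \<in> J" using a(2) by (auto simp: h_def)
    from W(4)[OF this] show "g (h (s, y)) = snd D (F (a s) (chart_inv C y))" by (simp add: h_def)
  qed
qed

text \<open>A single map is treated as a constant family whose extension ignores time. Results on
  families then specialize to maps: \<open>smooth_map_compose\<close> and
  \<open>smooth_map_crep\<close> are obtained in this way.\<close>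

lemma smooth_family_const:
  assumes f: "smooth_map A f"
  shows "smooth_family A I (\<lambda>_. f)"
proof (rule smooth_familyI)
  show "continuous_on (I \<times> UNIV) (\<lambda>(t, p). f p)"
    using f unfolding smooth_map_def case_prod_unfold
    by (auto intro!: continuous_intros continuous_on_compose2[of UNIV f])
next
  fix t :: real and p C D assume C: "C \<in> A" "p \<in> fst C" and D: "D \<in> A" "f p \<in> fst D"
  let ?S = "{y \<in> chart_image C. f (chart_inv C y) \<in> fst D}"
  have S: "snd C p \<in> ?S" using C D by (simp add: chart_in_image chart_inv_left)
  have "open ?S"
  proof -
    have "continuous_on (chart_image C) (\<lambda>y. f (chart_inv C y))"
      using f by (intro continuous_on_compose2[of UNIV f _ "chart_inv C"] chart_inv_cont C)
        (auto simp: smooth_map_def)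
    then have "open ((\<lambda>y. f (chart_inv C y)) -` fst D \<inter> chart_image C)"
      using chart_image_open[OF C(1)] chart_open[OF D(1)] by (metis continuous_on_open_vimage)
    moreover have "(\<lambda>y. f (chart_inv C y)) -` fst D \<inter> chart_image C = ?S" by auto
    ultimately show ?thesis by simp
  qed
  moreover have "smooth_on ?S (snd D \<circ> f \<circ> chart_inv C)" using f C D by (auto simp: smooth_map_def)
  ultimately have k: "Ck_on k ?S (snd D \<circ> f \<circ> chart_inv C)" for k by (simp add: smooth_on_open_iff)
  show "\<exists>W g. open W \<and> (t, snd C p) \<in> W \<and> (\<forall>k. Ck_on k W g) \<and>
        (\<forall>s y. (s, y) \<in> W \<longrightarrow> s \<in> I \<longrightarrow> y \<in> chart_image C \<longrightarrow>
          g (s, y) = snd D (f (chart_inv C y)))"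
  proof (intro exI conjI allI impI)
    show op: "open (UNIV \<times> ?S :: (real \<times> 'e) set)" using \<open>open ?S\<close> by (intro open_Times) auto
    show "(t, snd C p) \<in> UNIV \<times> ?S" using S by auto
    show "Ck_on k (UNIV \<times> ?S :: (real \<times> 'e) set) (\<lambda>z. (snd D \<circ> f \<circ> chart_inv C) (snd z))" for k
      by (rule Ck_on_compose[where f = snd, OF op \<open>open ?S\<close> _ _ k])
        (auto intro!: Ck_on_bounded_linear[OF bounded_linear_snd op] Ck_on_id)
  qed auto
qed

lemma smooth_family_slice:
  assumes F: "smooth_family A I F" and t: "t \<in> I"
  shows "smooth_map A (F t)"
  unfolding smooth_map_def
proof (intro conjI ballI)
  have "continuous_on UNIV (\<lambda>p. (\<lambda>(t, p). F t p) (t, p))"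
    using t by (intro continuous_on_compose2[OF smooth_family_cont[OF F]])
      (auto intro!: continuous_intros)
  then show "continuous_on UNIV (F t)" by simp
  fix C D assume CD: "C \<in> A" "D \<in> A"
  let ?S = "{y \<in> chart_image C. F t (chart_inv C y) \<in> fst D}"
  show "smooth_on ?S (snd D \<circ> F t \<circ> chart_inv C)"
    unfolding smooth_on_def
  proof
    fix y assume y: "y \<in> ?S"
    then have "chart_inv C y \<in> fst C" and yy: "snd C (chart_inv C y) = y"
      by (auto intro: chart_inv_in chart_inv_right)
    then obtain W g where W: "open W" "(t, y) \<in> W" "\<And>k. Ck_on k W g"
      "\<And>s y. (s, y) \<in> W \<Longrightarrow> s \<in> I \<Longrightarrow>
        y \<in> chart_image C \<and> F s (chart_inv C y) \<in> fst D \<and> g (s, y) = snd D (F s (chart_inv C y))"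
      using smooth_family_local_extension[OF F t CD(1) _ CD(2)] y by (metis (mono_tags, lifting) mem_Collect_eq)
    have pr: "Ck_on k UNIV (\<lambda>y::'e. (t, y))" for k by (intro Ck_on_Pair open_UNIV Ck_on_const Ck_on_id)
    have op: "open ((\<lambda>y. (t, y)) -` W)" using pr[of 0] W(1) by (simp add: continuous_on_open_vimage)
    show "\<exists>W g. open W \<and> y \<in> W \<and> (\<forall>k. Ck_on k W g) \<and>
        (\<forall>y\<in>W \<inter> ?S. g y = (snd D \<circ> F t \<circ> chart_inv C) y)"
    proof (intro exI conjI allI)
      show "Ck_on k ((\<lambda>y. (t, y)) -` W) (\<lambda>y. g (t, y))" for k
        by (rule Ck_on_compose[OF op W(1) _ _ W(3)]) (auto intro: Ck_on_subset[OF pr])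
    qed (use op W(2,4) t in auto)
  qed
qed

lemma smooth_map_compose:
  assumes "smooth_map A f" "smooth_map A g"
  shows "smooth_map A (g \<circ> f)"
  using smooth_family_slice[OF smooth_family_compose[OF smooth_family_const[OF assms(2)]
        smooth_family_const[OF assms(1)]], of 0 UNIV] by simp

lemma smooth_map_id: "smooth_map A id"
  unfolding smooth_map_def
proof (intro conjI ballI)
  fix C D assume CD: "C \<in> A" "D \<in> A"
  have "{y \<in> chart_image C. id (chart_inv C y) \<in> fst D} = snd C ` (fst C \<inter> fst D)"
    using CD by (auto simp: chart_image_def chart_inv_left)
  then show "smooth_on {y \<in> chart_image C. id (chart_inv C y) \<in> fst D} (snd D \<circ> id \<circ> chart_inv C)"
    using atlas CD unfolding smooth_atlas_def by auto
qed (simp add: continuous_on_id)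

section \<open>Derivatives of coordinate representations\<close>

lemma smooth_map_crep:
  assumes f: "smooth_map A f" and C: "C \<in> A" "p \<in> fst C" and D: "D \<in> A" "f p \<in> fst D"
  obtains U where "open U" "snd C p \<in> U" "\<And>k. Ck_on k U (crep C f D)"
    "\<And>y. y \<in> U \<Longrightarrow> y \<in> chart_image C \<and> f (chart_inv C y) \<in> fst D"
proof -
  obtain W g where W: "open W" "(0::real, snd C p) \<in> W" "\<And>k. Ck_on k W g"
    "\<And>s y. (s, y) \<in> W \<Longrightarrow> s \<in> UNIV \<Longrightarrow>
      y \<in> chart_image C \<and> f (chart_inv C y) \<in> fst D \<and> g (s, y) = snd D (f (chart_inv C y))"
    using smooth_family_local_extension[OF smooth_family_const[OF f, of UNIV] UNIV_I C D] by blast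
  have pr: "Ck_on k UNIV (\<lambda>y::'e. (0::real, y))" for k by (intro Ck_on_Pair open_UNIV Ck_on_const Ck_on_id)
  have op: "open ((\<lambda>y. (0::real, y)) -` W)" using pr[of 0] W(1) by (simp add: continuous_on_open_vimage)
  show thesis
  proof
    have "Ck_on k ((\<lambda>y. (0::real, y)) -` W) (\<lambda>y. g (0, y))" for k
      by (rule Ck_on_compose[OF op W(1) _ _ W(3)]) (auto intro: Ck_on_subset[OF pr])
    then show "Ck_on k ((\<lambda>y. (0::real, y)) -` W) (crep C f D)" for k
      by (rule Ck_on_cong[OF op]) (use W(4) in \<open>auto simp: crep_def\<close>)
  qed (use op W(2,4) in auto)
qed

lemma crep_has_derivative:
  assumes "smooth_map A f" "C \<in> A" "p \<in> fst C" "D \<in> A" "f p \<in> fst D"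
  shows "(crep C f D has_derivative dcrep C f D p) (at (snd C p))"
proof -
  obtain U where "snd C p \<in> U" "\<And>k. Ck_on k U (crep C f D)"
    by (rule smooth_map_crep[OF assms]) blast
  then show ?thesis unfolding dcrep_def by (intro Ck_on_differentiable) auto
qed

lemma dcrep_linear:
  assumes "smooth_map A f" "C \<in> A" "p \<in> fst C" "D \<in> A" "f p \<in> fst D"
  shows "linear (dcrep C f D p)"
  using crep_has_derivative[OF assms] by (rule has_derivative_linear)

text \<open>The coordinate representation of the composite factors through the chart E where f maps
  into the domain of E. This holds near \<open>snd C p\<close>, which suffices for the
  derivative.\<close>

lemma dcrep_compose:
  assumes f: "smooth_map A f" and g: "smooth_map A g"
    and C: "C \<in> A" "p \<in> fst C" and E: "E \<in> A" "f p \<in> fst E" and D: "D \<in> A" "g (f p) \<in> fst D"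
  shows "dcrep C (g \<circ> f) D p = dcrep E g D (f p) \<circ> dcrep C f E p"
proof -
  obtain U where U: "open U" "snd C p \<in> U"
    "\<And>y. y \<in> U \<Longrightarrow> y \<in> chart_image C \<and> f (chart_inv C y) \<in> fst E"
    by (rule smooth_map_crep[OF f C E]) blast
  have "crep C f E (snd C p) = snd E (f p)" using C by (simp add: crep_def chart_inv_left)
  then have "(crep E g D \<circ> crep C f E has_derivative dcrep E g D (f p) \<circ> dcrep C f E p) (at (snd C p))"
    using diff_chain_at[OF crep_has_derivative[OF f C E]] crep_has_derivative[OF g E D] by simp
  then have "(crep C (g \<circ> f) D has_derivative dcrep E g D (f p) \<circ> dcrep C f E p) (at (snd C p))"
    by (rule has_derivative_transform_within_open[OF _ U(1,2)])
      (use U(3) E in \<open>auto simp: crep_def chart_inv_left\<close>)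
  then show ?thesis unfolding dcrep_def by (rule frechet_derivative_at[symmetric])
qed

lemma dcrep_id:
  assumes "C \<in> A" "p \<in> fst C"
  shows "dcrep C id C p = id"
proof -
  have "(crep C id C has_derivative id) (at (snd C p))"
    by (rule has_derivative_transform_within_open[OF has_derivative_id chart_image_open[OF assms(1)]
        chart_in_image[OF assms(2)]]) (simp add: crep_def chart_inv_right)
  then show ?thesis unfolding dcrep_def by (rule frechet_derivative_at[symmetric])
qed

section \<open>Tangent vectors\<close>

lemma tangent_change:
  "v \<in> tangent_space A p \<Longrightarrow> C \<in> A \<Longrightarrow> p \<in> fst C \<Longrightarrow> D \<in> A \<Longrightarrow> p \<in> fst D \<Longrightarrow>
    v D = dcrep C id D p (v C)"
  unfolding tangent_space_def dcrep_def crep_def comp_id by blast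

lemma tangent_outside: "v \<in> tangent_space A p \<Longrightarrow> \<not> (C \<in> A \<and> p \<in> fst C) \<Longrightarrow> v C = 0"
  unfolding tangent_space_def by blast

lemma tangentI:
  assumes "\<And>C D. C \<in> A \<Longrightarrow> p \<in> fst C \<Longrightarrow> D \<in> A \<Longrightarrow> p \<in> fst D \<Longrightarrow> v D = dcrep C id D p (v C)"
    and "\<And>C. \<not> (C \<in> A \<and> p \<in> fst C) \<Longrightarrow> v C = 0"
  shows "v \<in> tangent_space A p"
  using assms unfolding tangent_space_def dcrep_def crep_def comp_id by blast

text \<open>Coordinates in one chart determine those in every other chart around p, and the value 0
  elsewhere makes the functions equal. Identities between tangent vectors are thus checked in a
  single chart.\<close>

lemma tangent_eqI:
  assumes "v \<in> tangent_space A p" "w \<in> tangent_space A p" "C \<in> A" "p \<in> fst C" "v C = w C"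
  shows "v = w"
proof
  fix D
  show "v D = w D"
    using assms(5) tangent_change[OF assms(1,3,4), of D] tangent_change[OF assms(2,3,4), of D]
      tangent_outside[OF assms(1), of D] tangent_outside[OF assms(2), of D]
    by (cases "D \<in> A \<and> p \<in> fst D") auto
qed

lemma tangent_lincomb:
  assumes v: "v \<in> tangent_space A p" and w: "w \<in> tangent_space A p"
  shows "(\<lambda>C. a *\<^sub>R v C + b *\<^sub>R w C) \<in> tangent_space A p"
proof (rule tangentI)
  fix C D assume CD: "C \<in> A" "p \<in> fst C" "D \<in> A" "p \<in> fst D"
  interpret linear "dcrep C id D p" by (rule dcrep_linear[OF smooth_map_id]) (use CD in auto)
  show "a *\<^sub>R v D + b *\<^sub>R w D = dcrep C id D p (a *\<^sub>R v C + b *\<^sub>R w C)"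
    using tangent_change[OF v CD] tangent_change[OF w CD] by (simp add: add scale)
qed (simp add: tangent_outside[OF v] tangent_outside[OF w])

lemma tvec_of_coords_apply:
  "D \<in> A \<Longrightarrow> p \<in> fst D \<Longrightarrow> tvec_of_coords A p C u D = dcrep C id D p u"
  by (simp add: tvec_of_coords_def dcrep_def crep_def)

lemma tvec_of_coords_self:
  "C \<in> A \<Longrightarrow> p \<in> fst C \<Longrightarrow> tvec_of_coords A p C u C = u"
  by (simp add: tvec_of_coords_apply dcrep_id)

text \<open>Compatibility of the coordinates in E and D is the cocycle identity for the transition
  from C through E to D.\<close>

lemma tvec_of_coords_in_tangent:
  assumes C: "C \<in> A" "p \<in> fst C"
  shows "tvec_of_coords A p C u \<in> tangent_space A p"
proof (rule tangentI)
  fix E D assume E: "E \<in> A" "p \<in> fst E" and D: "D \<in> A" "p \<in> fst D"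
  have "dcrep C id D p = dcrep E id D p \<circ> dcrep C id E p"
    using dcrep_compose[OF smooth_map_id smooth_map_id C, of E D] E D by simp
  then show "tvec_of_coords A p C u D = dcrep E id D p (tvec_of_coords A p C u E)"
    using E D by (simp add: tvec_of_coords_apply)
qed (auto simp: tvec_of_coords_def)

lemma tvec_of_coords_eq:
  "v \<in> tangent_space A p \<Longrightarrow> C \<in> A \<Longrightarrow> p \<in> fst C \<Longrightarrow> tvec_of_coords A p C (v C) = v"
  by (rule tangent_eqI[of _ p]) (auto simp: tvec_of_coords_self tvec_of_coords_in_tangent)

text \<open>\<open>pushforward\<close> is defined through the chosen chart at p; the chain rule for
  f after the identity shows that every chart C around p gives the same vector.\<close>

lemma pushforward_apply:
  assumes f: "smooth_map A f" and v: "v \<in> tangent_space A p"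
    and C: "C \<in> A" "p \<in> fst C" and D: "D \<in> A" "f p \<in> fst D"
  shows "pushforward A f p v D = dcrep C f D p (v C)"
proof -
  let ?C = "chart_at A p"
  have "dcrep C (f \<circ> id) D p = dcrep ?C f D (id p) \<circ> dcrep C id ?C p"
    by (rule dcrep_compose[OF smooth_map_id f C]) (use D chart_at in auto)
  then have "dcrep C f D p (v C) = dcrep ?C f D p (v ?C)"
    using tangent_change[OF v C chart_at] by simp
  then show ?thesis using D by (simp add: pushforward_def Let_def dcrep_def crep_def)
qed

lemma pushforward_in_tangent:
  assumes f: "smooth_map A f" and v: "v \<in> tangent_space A p"
  shows "pushforward A f p v \<in> tangent_space A (f p)"
proof (rule tangentI)
  fix E D assume E: "E \<in> A" "f p \<in> fst E" and D: "D \<in> A" "f p \<in> fst D"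
  have "dcrep (chart_at A p) (id \<circ> f) D p = dcrep E id D (f p) \<circ> dcrep (chart_at A p) f E p"
    by (rule dcrep_compose[OF f smooth_map_id chart_at E]) (use D in auto)
  then show "pushforward A f p v D = dcrep E id D (f p) (pushforward A f p v E)"
    using pushforward_apply[OF f v chart_at] E D by simp
qed (auto simp: pushforward_def Let_def)

lemma pushforward_compose:
  assumes f: "smooth_map A f" and g: "smooth_map A g" and v: "v \<in> tangent_space A p"
  shows "pushforward A (g \<circ> f) p v = pushforward A g (f p) (pushforward A f p v)"
proof (rule tangent_eqI[of _ "g (f p)"])
  let ?C = "chart_at A p" and ?E = "chart_at A (f p)" and ?D = "chart_at A (g (f p))"
  show "pushforward A (g \<circ> f) p v \<in> tangent_space A (g (f p))"
    using pushforward_in_tangent[OF smooth_map_compose[OF f g] v] by simp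
  show "pushforward A g (f p) (pushforward A f p v) \<in> tangent_space A (g (f p))"
    by (intro pushforward_in_tangent f g v)
  show "?D \<in> A" "g (f p) \<in> fst ?D" by (rule chart_at)+
  show "pushforward A (g \<circ> f) p v ?D = pushforward A g (f p) (pushforward A f p v) ?D"
    using pushforward_apply[OF smooth_map_compose[OF f g] v chart_at, of ?D]
      pushforward_apply[OF f v chart_at chart_at]
      pushforward_apply[OF g pushforward_in_tangent[OF f v] chart_at chart_at]
      dcrep_compose[OF f g chart_at chart_at chart_at] chart_at
    by simp
qed

lemma pushforward_id:
  assumes "v \<in> tangent_space A p"
  shows "pushforward A id p v = v"
proof (rule tangent_eqI[OF _ assms chart_at])
  show "pushforward A id p v \<in> tangent_space A p"
    using pushforward_in_tangent[OF smooth_map_id assms] by simp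
  show "pushforward A id p v (chart_at A p) = v (chart_at A p)"
    using pushforward_apply[OF smooth_map_id assms chart_at, of "chart_at A p"] chart_at
    by (simp add: dcrep_id)
qed

end

section \<open>Velocities\<close>

context atlas_manifold
begin

lemma curve_change_chart:
  assumes c: "continuous_on I c" and t: "t \<in> I"
    and C: "C \<in> A" "c t \<in> fst C" and D: "D \<in> A" "c t \<in> fst D"
    and u: "((\<lambda>s. snd C (c s)) has_vector_derivative u) (at t within I)"
  shows "((\<lambda>s. snd D (c s)) has_vector_derivative dcrep C id D (c t) u) (at t within I)"
proof -
  have d: "(crep C id D has_derivative dcrep C id D (c t)) (at (snd C (c t)))"
    by (rule crep_has_derivative[OF smooth_map_id C]) (use D in auto)
  have "((\<lambda>s. crep C id D (snd C (c s))) has_vector_derivative dcrep C id D (c t) u) (at t within I)"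
    using has_derivative_compose[OF u[unfolded has_vector_derivative_def] d]
    by (simp add: has_vector_derivative_def linear_cmul[OF has_derivative_linear[OF d]])
  moreover have "\<forall>\<^sub>F s in at t within I. c s \<in> fst C"
    using c t chart_open[OF C(1)] C(2) unfolding continuous_on_def
    by (auto intro: topological_tendstoD)
  then have "\<forall>\<^sub>F s in at t within I. crep C id D (snd C (c s)) = snd D (c s)"
    by eventually_elim (simp add: crep_def chart_inv_left[OF C(1)])
  ultimately show ?thesis unfolding has_vector_derivative_def
    by (rule has_derivative_transform_eventually) (use t C in \<open>auto simp: crep_def chart_inv_left\<close>)
qed

text \<open>The chain rule for g along the curve \<open>\<lambda>s. (s, snd C (c s))\<close>, whose
  velocity is (1, u). A constant c gives the velocity of a single point under the family.\<close>

lemma family_curve_derivative: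
  assumes c: "continuous_on I c" and t: "t \<in> I" and C: "C \<in> A" "c t \<in> fst C"
    and u: "((\<lambda>s. snd C (c s)) has_vector_derivative u) (at t within I)"
    and W: "open W" "(t, snd C (c t)) \<in> W" "\<And>k. Ck_on k W g"
      "\<And>s y. (s, y) \<in> W \<Longrightarrow> s \<in> I \<Longrightarrow> g (s, y) = snd D (F s (chart_inv C y))"
  shows "((\<lambda>s. snd D (F s (c s))) has_vector_derivative
      frechet_derivative g (at (t, snd C (c t))) (1, u)) (at t within I)"
proof -
  have d: "(g has_derivative frechet_derivative g (at (t, snd C (c t)))) (at (t, snd C (c t)))"
    by (rule Ck_on_differentiable[OF W(3) W(2)])
  have pr: "((\<lambda>s. (s, snd C (c s))) has_derivative (\<lambda>h. (h, h *\<^sub>R u))) (at t within I)"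
    using u unfolding has_vector_derivative_def by (intro has_derivative_Pair has_derivative_ident)
  have "((\<lambda>s. g (s, snd C (c s))) has_derivative
      (\<lambda>h. frechet_derivative g (at (t, snd C (c t))) (h *\<^sub>R (1, u)))) (at t within I)"
    using has_derivative_compose[OF pr d] by simp
  then have *: "((\<lambda>s. g (s, snd C (c s))) has_derivative
      (\<lambda>h. h *\<^sub>R frechet_derivative g (at (t, snd C (c t))) (1, u))) (at t within I)"
    by (simp only: linear_cmul[OF has_derivative_linear[OF d]])
  have "\<forall>\<^sub>F s in at t within I. c s \<in> fst C"
    using c t chart_open[OF C(1)] C(2) unfolding continuous_on_def
    by (auto intro: topological_tendstoD)
  moreover have "((\<lambda>s. (s, snd C (c s))) \<longlongrightarrow> (t, snd C (c t))) (at t within I)"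
    using has_derivative_continuous[OF pr] by (simp add: continuous_within)
  then have "\<forall>\<^sub>F s in at t within I. (s, snd C (c s)) \<in> W"
    by (rule topological_tendstoD[OF _ W(1,2)])
  moreover have "\<forall>\<^sub>F s in at t within I. s \<in> I" by (simp add: eventually_at_filter)
  ultimately have "\<forall>\<^sub>F s in at t within I. g (s, snd C (c s)) = snd D (F s (c s))"
    by eventually_elim (simp add: W(4) chart_inv_left[OF C(1)])
  then show ?thesis unfolding has_vector_derivative_def
    by (rule has_derivative_transform_eventually[OF *])
      (use t C W(2) in \<open>auto simp: W(4) chart_inv_left\<close>)
qed

text \<open>Counterpart of \<open>family_curve_derivative\<close>: with time frozen, the directions
  (0, u) of the extension compute the Jacobian of F t.\<close>

lemma dcrep_local_extension:
  assumes t: "t \<in> I" and C: "C \<in> A" "p \<in> fst C"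
    and W: "open W" "(t, snd C p) \<in> W" "\<And>k. Ck_on k W g"
      "\<And>s y. (s, y) \<in> W \<Longrightarrow> s \<in> I \<Longrightarrow> g (s, y) = snd D (F s (chart_inv C y))"
  shows "dcrep C (F t) D p u = frechet_derivative g (at (t, snd C p)) (0, u)"
proof -
  have d: "(g has_derivative frechet_derivative g (at (t, snd C p))) (at (t, snd C p))"
    by (rule Ck_on_differentiable[OF W(3) W(2)])
  have pr: "((\<lambda>y. (t, y)) has_derivative (\<lambda>h. (0, h))) (at (snd C p))"
    by (intro has_derivative_Pair has_derivative_ident has_derivative_const)
  have cont: "continuous_on UNIV (\<lambda>y::'e. (t, y))" by (intro continuous_intros)
  have "open ((\<lambda>y. (t, y)) -` W)"
    by (rule open_vimage[OF W(1) cont])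
  then have "(crep C (F t) D has_derivative
      (\<lambda>h. frechet_derivative g (at (t, snd C p)) (0, h))) (at (snd C p))"
    by (rule has_derivative_transform_within_open[OF has_derivative_compose[OF pr d]])
      (use W(2) in \<open>auto simp: W(4) t crep_def\<close>)
  from fun_cong[OF frechet_derivative_at[OF this], of u] show ?thesis by (simp add: dcrep_def)
qed

lemma smooth_family_curve_cont:
  assumes F: "smooth_family A I F"
  shows "continuous_on I (\<lambda>s. F s p)"
proof -
  have "continuous_on I (\<lambda>s. (\<lambda>(t, p). F t p) (s, p))"
    by (rule continuous_on_compose2[OF smooth_family_cont[OF F]]) (auto intro!: continuous_intros)
  then show ?thesis by simp
qed

text \<open>The coordinates are the derivatives within I in each chart. They are compatible because
  such derivatives are unique, which is what \<open>at t within I \<noteq> bot\<close>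
  provides.\<close>

lemma ex_velocity:
  assumes F: "smooth_family A I F" and t: "t \<in> I" "at t within I \<noteq> bot"
  shows "\<exists>v. has_velocity A I (\<lambda>s. F s p) t v"
proof -
  define v where "v C = (if C \<in> A \<and> F t p \<in> fst C
    then vector_derivative (\<lambda>s. snd C (F s p)) (at t within I) else 0)" for C
  have cont: "continuous_on I (\<lambda>s. F s p)" by (rule smooth_family_curve_cont[OF F])
  have v: "((\<lambda>s. snd D (F s p)) has_vector_derivative v D) (at t within I)"
    if D: "D \<in> A" "F t p \<in> fst D" for D
  proof -
    obtain C where C: "C \<in> A" "p \<in> fst C" using ex_chart by blast
    obtain W g where "open W" "(t, snd C p) \<in> W" "\<And>k. Ck_on k W g"
      "\<And>s y. (s, y) \<in> W \<Longrightarrow> s \<in> I \<Longrightarrow>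
        y \<in> chart_image C \<and> F s (chart_inv C y) \<in> fst D \<and> g (s, y) = snd D (F s (chart_inv C y))"
      by (rule smooth_family_local_extension[OF F t(1) C D]) blast
    then have "((\<lambda>s. snd D (F s p)) has_vector_derivative
        frechet_derivative g (at (t, snd C p)) (1, 0)) (at t within I)"
      using C t by (intro family_curve_derivative[where c = "\<lambda>_. p"]) (auto intro: continuous_on_const)
    then have "((\<lambda>s. snd D (F s p)) has_vector_derivative
        vector_derivative (\<lambda>s. snd D (F s p)) (at t within I)) (at t within I)"
      using vector_derivative_within[OF t(2)] by metis
    then show ?thesis using D by (simp add: v_def)
  qed
  have "v \<in> tangent_space A (F t p)"
  proof (rule tangentI)
    fix C D assume CD: "C \<in> A" "F t p \<in> fst C" "D \<in> A" "F t p \<in> fst D"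
    show "v D = dcrep C id D (F t p) (v C)"
      using vector_derivative_within[OF t(2) curve_change_chart[OF cont t(1) CD v[OF CD(1,2)]]]
        vector_derivative_within[OF t(2) v[OF CD(3,4)]] by simp
  qed (auto simp: v_def)
  then show ?thesis unfolding has_velocity_def using v by auto
qed

text \<open>The product rule for a moving point under a moving map: by linearity the derivative of
  the extension in direction (1, v) splits into its parts (1, 0) and (0, v). It yields the
  generating field of \<open>\<lambda>t. \<phi> (a t) \<circ> \<Psi> t\<close>.\<close>

lemma has_velocity_family_curve:
  assumes F: "smooth_family A I F" and c: "continuous_on I c" and t: "t \<in> I" "at t within I \<noteq> bot"
    and w: "has_velocity A I (\<lambda>s. F s (c t)) t w" and v: "has_velocity A I c t v"
  shows "has_velocity A I (\<lambda>s. F s (c s)) t (\<lambda>D. w D + pushforward A (F t) (c t) v D)"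
  unfolding has_velocity_def
proof (intro conjI ballI impI)
  have sm: "smooth_map A (F t)" by (rule smooth_family_slice[OF F t(1)])
  have vT: "v \<in> tangent_space A (c t)" and wT: "w \<in> tangent_space A (F t (c t))"
    using v w by (auto simp: has_velocity_def)
  show "(\<lambda>D. w D + pushforward A (F t) (c t) v D) \<in> tangent_space A (F t (c t))"
    using tangent_lincomb[OF wT pushforward_in_tangent[OF sm vT], of 1 1] by simp
  fix D assume D: "D \<in> A" "F t (c t) \<in> fst D"
  obtain C where C: "C \<in> A" "c t \<in> fst C" using ex_chart by blast
  obtain W g where W: "open W" "(t, snd C (c t)) \<in> W" "\<And>k. Ck_on k W g"
    "\<And>s y. (s, y) \<in> W \<Longrightarrow> s \<in> I \<Longrightarrow>
      y \<in> chart_image C \<and> F s (chart_inv C y) \<in> fst D \<and> g (s, y) = snd D (F s (chart_inv C y))"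
    by (rule smooth_family_local_extension[OF F t(1) C D]) blast
  have W4: "\<And>s y. (s, y) \<in> W \<Longrightarrow> s \<in> I \<Longrightarrow> g (s, y) = snd D (F s (chart_inv C y))"
    using W(4) by blast
  let ?g' = "frechet_derivative g (at (t, snd C (c t)))"
  have "((\<lambda>s. snd D (F s (c t))) has_vector_derivative ?g' (1, 0)) (at t within I)"
    by (rule family_curve_derivative[where c = "\<lambda>_. c t", OF _ t(1) C _ W(1-3) W4])
      (auto intro: continuous_on_const)
  moreover have "((\<lambda>s. snd D (F s (c t))) has_vector_derivative w D) (at t within I)"
    using w D by (auto simp: has_velocity_def)
  ultimately have 1: "?g' (1, 0) = w D" using vector_derivative_within[OF t(2)] by metis
  have 2: "?g' (0, v C) = pushforward A (F t) (c t) v D"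
    using pushforward_apply[OF sm vT C D] dcrep_local_extension[OF t(1) C W(1-3) W4] by simp
  have "((\<lambda>s. snd D (F s (c s))) has_vector_derivative ?g' (1, v C)) (at t within I)"
    by (rule family_curve_derivative[OF c t(1) C _ W(1-3) W4])
      (use v C in \<open>auto simp: has_velocity_def\<close>)
  moreover have "?g' (1, v C) = ?g' (1, 0) + ?g' (0, v C)"
    using linear_add[OF has_derivative_linear[OF Ck_on_differentiable[OF W(3) W(2)]], of "(1, 0)" "(0, v C)"]
    by simp
  ultimately show "((\<lambda>s. snd D (F s (c s))) has_vector_derivative
      w D + pushforward A (F t) (c t) v D) (at t within I)"
    using 1 2 by simp
qed

lemma has_velocity_reparam:
  assumes v: "has_velocity A J c (a t) v" and a: "(a has_real_derivative a') (at t within I)" "a ` I \<subseteq> J"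
  shows "has_velocity A I (\<lambda>s. c (a s)) t (\<lambda>C. a' *\<^sub>R v C)"
  unfolding has_velocity_def
proof (intro conjI ballI impI)
  have "v \<in> tangent_space A (c (a t))" using v by (simp add: has_velocity_def)
  from tangent_lincomb[OF this this, of a' 0]
  show "(\<lambda>C. a' *\<^sub>R v C) \<in> tangent_space A (c (a t))" by simp
  fix C assume C: "C \<in> A" "c (a t) \<in> fst C"
  have "((\<lambda>s. snd C (c s)) has_vector_derivative v C) (at (a t) within a ` I)"
    using v C a(2) by (auto simp: has_velocity_def intro: has_vector_derivative_within_subset)
  from vector_diff_chain_within[OF _ this, of a'] a(1)
  show "((\<lambda>s. snd C (c (a s))) has_vector_derivative a' *\<^sub>R v C) (at t within I)"
    by (simp add: o_def has_real_derivative_iff_has_vector_derivative)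
qed

end

section \<open>One-forms in coordinates\<close>

locale one_form_manifold = atlas_manifold A
  for A :: "('a::topological_space, 'e::euclidean_space) chart set" +
  fixes \<alpha> :: "('a, 'e) oneform"
  assumes one_form: "smooth_one_form A \<alpha>"
begin

text \<open>The direction u comes before the point, so that \<open>form_coord C u\<close> is a
  function on an open set of Euclidean space; it is the function that \<open>ext_deriv\<close>
  differentiates.\<close>

definition form_coord :: "('a, 'e) chart \<Rightarrow> 'e \<Rightarrow> 'e \<Rightarrow> real" where
  "form_coord C u y = \<alpha> (chart_inv C y) (tvec_of_coords A (chart_inv C y) C u)"

lemma form_lincomb:
  "v \<in> tangent_space A p \<Longrightarrow> w \<in> tangent_space A p \<Longrightarrow>
    \<alpha> p (\<lambda>C. a *\<^sub>R v C + b *\<^sub>R w C) = a * \<alpha> p v + b * \<alpha> p w"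
  using one_form unfolding smooth_one_form_def by blast

lemma form_uminus: "v \<in> tangent_space A p \<Longrightarrow> \<alpha> p (\<lambda>C. - v C) = - \<alpha> p v"
  using form_lincomb[of v p v "-1" 0] by simp

lemma form_coord_Ck: "C \<in> A \<Longrightarrow> Ck_on k (chart_image C) (form_coord C u)"
  using one_form chart_image_open unfolding smooth_one_form_def form_coord_def[abs_def]
  by (simp add: smooth_on_open_iff)

lemma form_coord_linear:
  assumes C: "C \<in> A" "y \<in> chart_image C"
  shows "linear (\<lambda>u. form_coord C u y)"
proof -
  let ?p = "chart_inv C y"
  have p: "?p \<in> fst C" using C by (simp add: chart_inv_in)
  have lin: "form_coord C (a *\<^sub>R u + b *\<^sub>R w) y = a * form_coord C u y + b * form_coord C w y" for a b u w
  proof -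
    have "tvec_of_coords A ?p C (a *\<^sub>R u + b *\<^sub>R w) =
        (\<lambda>D. a *\<^sub>R tvec_of_coords A ?p C u D + b *\<^sub>R tvec_of_coords A ?p C w D)"
      by (rule tangent_eqI[OF _ _ C(1) p])
        (auto simp: tvec_of_coords_self C p intro!: tangent_lincomb tvec_of_coords_in_tangent)
    then show ?thesis
      unfolding form_coord_def using C p by (simp add: form_lincomb tvec_of_coords_in_tangent)
  qed
  show ?thesis
  proof (rule linearI)
    show "form_coord C (u + w) y = form_coord C u y + form_coord C w y" for u w
      using lin[of 1 u 1 w] by simp
    show "form_coord C (a *\<^sub>R u) y = a *\<^sub>R form_coord C u y" for a u
      using lin[of a u 0 u] by simp
  qed
qed

lemma form_coord_sum:
  assumes C: "C \<in> A" "y \<in> chart_image C"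
  shows "form_coord C u y = (\<Sum>i\<in>Basis. (u \<bullet> i) * form_coord C i y)"
proof -
  interpret linear "\<lambda>u. form_coord C u y" by (rule form_coord_linear[OF C])
  have "form_coord C (\<Sum>i\<in>Basis. (u \<bullet> i) *\<^sub>R i) y = (\<Sum>i\<in>Basis. (u \<bullet> i) * form_coord C i y)"
    by (simp only: sum scale real_scaleR_def)
  then show ?thesis by (simp only: euclidean_representation)
qed

text \<open>Separates the vector from the point. Coordinates and coefficients both take values in
  fixed spaces, so \<alpha> of a vector moving along a curve can be differentiated by the product
  rule.\<close>

lemma form_eq_coord:
  assumes v: "v \<in> tangent_space A p" and C: "C \<in> A" "p \<in> fst C"
  shows "\<alpha> p v = (\<Sum>i\<in>Basis. (v C \<bullet> i) * form_coord C i (snd C p))"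
proof -
  have "\<alpha> p v = form_coord C (v C) (snd C p)"
    using C tvec_of_coords_eq[OF v C] by (simp add: form_coord_def chart_inv_left)
  also note form_coord_sum[OF C(1) chart_in_image[OF C(2)]]
  finally show ?thesis .
qed

lemma form_coord_has_derivative:
  assumes "C \<in> A" "y \<in> chart_image C"
  shows "(form_coord C u has_derivative frechet_derivative (form_coord C u) (at y)) (at y)"
  by (rule Ck_on_differentiable[OF form_coord_Ck assms(2)]) (rule assms)

lemma ext_deriv_coord:
  assumes "C = chart_at A p"
  shows "ext_deriv A \<alpha> p v w =
    (\<Sum>i\<in>Basis. (w C \<bullet> i) * frechet_derivative (form_coord C i) (at (snd C p)) (v C)) -
    (\<Sum>i\<in>Basis. (v C \<bullet> i) * frechet_derivative (form_coord C i) (at (snd C p)) (w C))"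
proof -
  have C: "C \<in> A" "p \<in> fst C" using assms chart_at by auto
  have eq: "frechet_derivative (form_coord C u) (at (snd C p)) h =
      (\<Sum>i\<in>Basis. (u \<bullet> i) * frechet_derivative (form_coord C i) (at (snd C p)) h)" for u h
  proof -
    have "((\<lambda>y. \<Sum>i\<in>Basis. (u \<bullet> i) * form_coord C i y) has_derivative
        (\<lambda>h. \<Sum>i\<in>Basis. (u \<bullet> i) * frechet_derivative (form_coord C i) (at (snd C p)) h)) (at (snd C p))"
      by (intro has_derivative_sum has_derivative_mult_right form_coord_has_derivative
          C(1) chart_in_image[OF C(2)])
    then have "(form_coord C u has_derivative
        (\<lambda>h. \<Sum>i\<in>Basis. (u \<bullet> i) * frechet_derivative (form_coord C i) (at (snd C p)) h)) (at (snd C p))"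
      by (rule has_derivative_transform_within_open[OF _ chart_image_open[OF C(1)]
            chart_in_image[OF C(2)]]) (rule form_coord_sum[OF C(1), symmetric])
    from fun_cong[OF frechet_derivative_at[OF this], of h] show ?thesis by simp
  qed
  have coord: "(\<lambda>y. \<alpha> (chart_inv C y) (tvec_of_coords A (chart_inv C y) C u)) = form_coord C u" for u
    by (simp add: form_coord_def fun_eq_iff)
  show ?thesis
    unfolding ext_deriv_def Let_def assms(1)[symmetric] coord
    by (simp only: eq[of "w C" "v C"] eq[of "v C" "w C"])
qed

end

section \<open>The Reeb flow\<close>

locale reeb_flow = one_form_manifold A \<alpha>
  for A :: "('a::topological_space, 'e::euclidean_space) chart set" and \<alpha> +
  fixes R :: "'a \<Rightarrow> ('a, 'e) tvec" and \<phi> :: "real \<Rightarrow> 'a \<Rightarrow> 'a"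
  assumes reeb: "reeb_field A \<alpha> R" and flow: "flow_of A R \<phi>"
begin

lemma flow_family: "smooth_family A UNIV \<phi>"
  and flow_0: "\<phi> 0 = id"
  and flow_add: "\<phi> (s + t) = \<phi> s \<circ> \<phi> t"
  and flow_velocity: "has_velocity A UNIV (\<lambda>s. \<phi> s p) t (R (\<phi> t p))"
  using flow unfolding flow_of_def by auto

lemma flow_smooth: "smooth_map A (\<phi> t)"
  using smooth_family_slice[OF flow_family] by simp

lemma reeb_tangent: "R p \<in> tangent_space A p"
  and reeb_form: "\<alpha> p (R p) = 1"
  and reeb_ext_deriv: "v \<in> tangent_space A p \<Longrightarrow> ext_deriv A \<alpha> p (R p) v = 0"
  using reeb unfolding reeb_field_def smooth_vector_field_def by auto

text \<open>The vanishing of the Lie derivative of \<open>\<alpha>\<close> along \<open>R\<close>, in coordinates: differentiate \<open>\<alpha>(R) = 1\<close> and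
  subtract \<open>d\<alpha>(R, \<cdot>) = 0\<close>.\<close>

lemma flow_form_derivative_at_0:
  assumes w: "w \<in> tangent_space A q"
  shows "((\<lambda>s. \<alpha> (\<phi> s q) (pushforward A (\<phi> s) q w)) has_real_derivative 0) (at 0)"
proof -
  define C where "C = chart_at A q"
  have C: "C \<in> A" "q \<in> fst C" unfolding C_def by (rule chart_at)+
  define y0 where "y0 = snd C q"
  have y0: "y0 \<in> chart_image C" using C by (simp add: y0_def chart_in_image)
  define u where "u = w C"
  have C0: "\<phi> 0 q \<in> fst C" using C by (simp add: flow_0)
  obtain W g where W: "open W" "(0, snd C q) \<in> W" "\<And>k. Ck_on k W g"
    "\<And>s y. (s, y) \<in> W \<Longrightarrow> s \<in> UNIV \<Longrightarrow>
      y \<in> chart_image C \<and> \<phi> s (chart_inv C y) \<in> fst C \<and> g (s, y) = snd C (\<phi> s (chart_inv C y))"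
    using smooth_family_local_extension[OF flow_family UNIV_I C C(1) C0] by blast
  have W2: "(0, y0) \<in> W" using W(2) by (simp add: y0_def)
  have Wg: "\<And>s y. (s, y) \<in> W \<Longrightarrow> s \<in> UNIV \<Longrightarrow> g (s, y) = snd C (\<phi> s (chart_inv C y))"
    using W(4) by blast
  \<comment> \<open>P and Q are partial derivatives of the flow in coordinates: P in time, Q in the
    direction u. By the flow equation P is the Reeb field X at g, and Q at (s, y0) is the
    pushforward of w.\<close>
  define P where "P z = frechet_derivative g (at z) (1, 0)" for z
  define Q where "Q z = frechet_derivative g (at z) (0, u)" for z
  define X where "X y = R (chart_inv C y) C" for y
  have X: "Ck_on k (chart_image C) X" for k
    using reeb C chart_image_open unfolding reeb_field_def smooth_vector_field_def X_def[abs_def]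
    by (simp add: smooth_on_open_iff)
  have P: "P (s, y) = X (g (s, y))" if "(s, y) \<in> W" for s y
  proof -
    let ?p = "chart_inv C y"
    have p: "snd C ?p = y" "?p \<in> fst C" "\<phi> s ?p \<in> fst C" "g (s, y) = snd C (\<phi> s ?p)"
      using W(4)[OF that] by (auto simp: chart_inv_right chart_inv_in)
    have "((\<lambda>s. snd C (\<phi> s ?p)) has_vector_derivative
        frechet_derivative g (at (s, snd C ?p)) (1, 0)) (at s within UNIV)"
      by (rule family_curve_derivative[where c = "\<lambda>_. ?p" and F = \<phi>, OF _ _ C(1) _ _ W(1) _ W(3) Wg])
        (use p that in \<open>auto intro: continuous_on_const\<close>)
    then have "((\<lambda>s. snd C (\<phi> s ?p)) has_vector_derivative P (s, y)) (at s)"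
      by (simp add: P_def p)
    moreover have "((\<lambda>s. snd C (\<phi> s ?p)) has_vector_derivative R (\<phi> s ?p) C) (at s)"
      using flow_velocity[of ?p s] C p unfolding has_velocity_def by auto
    ultimately have "P (s, y) = R (\<phi> s ?p) C" by (rule vector_derivative_unique_at)
    also have "\<dots> = X (g (s, y))" using p C by (simp add: X_def chart_inv_left)
    finally show ?thesis .
  qed
  have Q: "pushforward A (\<phi> s) q w C = Q (s, y0)" if "(s, y0) \<in> W" for s
  proof -
    have "\<phi> s q \<in> fst C" using W(4)[OF that] C by (simp add: y0_def chart_inv_left)
    then have "pushforward A (\<phi> s) q w C = dcrep C (\<phi> s) C q u"
      using pushforward_apply[OF flow_smooth w C] C by (simp add: u_def)
    also have "\<dots> = Q (s, y0)" unfolding Q_def y0_def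
      by (rule dcrep_local_extension[where F = \<phi>, OF UNIV_I C W(1) _ W(3) Wg])
        (use that in \<open>auto simp: y0_def\<close>)
    finally show ?thesis .
  qed
  have g0: "g (0, y) = y" if "(0, y) \<in> W" for y
    using W(4)[OF that] by (simp add: flow_0 chart_inv_right)
  let ?X' = "frechet_derivative X (at y0)" and ?P' = "frechet_derivative P (at (0, y0))"
    and ?Q' = "frechet_derivative Q (at (0, y0))"
  have dX: "(X has_derivative ?X') (at y0)" by (rule Ck_on_differentiable[OF X y0])
  have g': "Ck_on (Suc 0) W (\<lambda>z. frechet_derivative g (at z) v)" for v
    using W(3)[of "Suc (Suc 0)"] unfolding Ck_on.simps(2)[of "Suc 0"] by blast
  have dP: "(P has_derivative ?P') (at (0, y0))"
    unfolding P_def[abs_def] by (rule Ck_on_differentiable[OF g' W2])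
  have dQ: "(Q has_derivative ?Q') (at (0, y0))"
    unfolding Q_def[abs_def] by (rule Ck_on_differentiable[OF g' W2])
  \<comment> \<open>As g (0, y) = y, the flow equation at time 0 reads P (0, y) = X y, and it is
    differentiated in the direction u.\<close>
  have "?P' (0, u) = ?X' u"
  proof -
    have pr: "((\<lambda>y. (0::real, y)) has_derivative (\<lambda>h. (0, h))) (at y0)"
      by (intro has_derivative_Pair has_derivative_ident has_derivative_const)
    have cont: "continuous_on UNIV (\<lambda>y::'e. (0::real, y))" by (intro continuous_intros)
    have "(X has_derivative (\<lambda>h. ?P' (0, h))) (at y0)"
      by (rule has_derivative_transform_within_open[OF has_derivative_compose[OF pr dP]
            open_vimage[OF W(1) cont]]) (use W2 in \<open>auto simp: P g0\<close>)
    from fun_cong[OF frechet_derivative_at[OF this], of u] show ?thesis by simp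
  qed
  \<comment> \<open>Symmetry of second derivatives gives the linearized flow equation at time 0: the
    pushed vector changes at the rate DX(u).\<close>
  moreover have "?Q' (1, 0) = ?P' (0, u)"
    using second_derivative_symmetric[OF W(1) W2 W(3), of "(0, u)" "(1, 0)"]
    by (simp add: P_def[abs_def] Q_def[abs_def])
  ultimately have Q': "?Q' (1, 0) = ?X' u" by simp
  have pr: "((\<lambda>s. (s, y0)) has_derivative (\<lambda>h. (h, 0))) (at 0)"
    by (intro has_derivative_Pair has_derivative_ident has_derivative_const)
  have curve: "((\<lambda>s. f (s, y0)) has_vector_derivative f' (1, 0)) (at 0)"
    if f: "(f has_derivative f') (at (0, y0))" for f :: "real \<times> 'e \<Rightarrow> 'e" and f'
  proof -
    have "f' (h, 0) = h *\<^sub>R f' (1, 0)" for h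
      using linear_cmul[OF has_derivative_linear[OF f], of h "(1, 0)"] by simp
    then have "(\<lambda>h. f' (h, 0)) = (\<lambda>h. h *\<^sub>R f' (1, 0))" by (rule ext)
    then show ?thesis
      using has_derivative_compose[OF pr f] by (simp only: has_vector_derivative_def)
  qed
  have Qs: "((\<lambda>s. Q (s, y0)) has_vector_derivative ?X' u) (at 0)"
    using curve[OF dQ] by (simp only: Q')
  have "(g has_derivative frechet_derivative g (at (0, y0))) (at (0, y0))"
    by (rule Ck_on_differentiable[OF W(3) W2])
  from curve[OF this] have gs: "((\<lambda>s. g (s, y0)) has_vector_derivative X y0) (at 0)"
    using P[OF W2] g0[OF W2] by (simp add: P_def)
  let ?f = "\<lambda>i. form_coord C i" and ?f' = "\<lambda>i. frechet_derivative (form_coord C i) (at y0)"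
  have Q0: "Q (0, y0) = u"
    using Q[OF W2] pushforward_id[OF w] by (simp add: flow_0 u_def)
  have df: "(?f i has_derivative ?f' i) (at y0)" for i
    by (rule form_coord_has_derivative[OF C(1) y0])
  have fs: "((\<lambda>s. ?f i (g (s, y0))) has_real_derivative ?f' i (X y0)) (at 0)" for i
    using has_derivative_compose[OF gs[unfolded has_vector_derivative_def], of "?f i" "?f' i"]
      df[of i] g0[OF W2] linear_cmul[OF has_derivative_linear[OF df[of i]]]
    by (simp add: has_field_derivative_def mult_commute_abs)
  have Qi: "((\<lambda>s. Q (s, y0) \<bullet> i) has_real_derivative ?X' u \<bullet> i) (at 0)" for i
    using has_derivative_inner_left[OF Qs[unfolded has_vector_derivative_def], of i]
    by (simp add: has_field_derivative_def mult_commute_abs)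
  have sum: "((\<lambda>s. \<Sum>i\<in>Basis. (Q (s, y0) \<bullet> i) * ?f i (g (s, y0))) has_real_derivative
      (\<Sum>i\<in>Basis. (?X' u \<bullet> i) * ?f i y0 + ?f' i (X y0) * (u \<bullet> i))) (at 0)"
    using DERIV_mult[OF Qi fs] by (intro DERIV_sum) (simp add: Q0 g0[OF W2])
  have "((\<lambda>s. \<alpha> (\<phi> s q) (pushforward A (\<phi> s) q w)) has_real_derivative
      (\<Sum>i\<in>Basis. (?X' u \<bullet> i) * ?f i y0 + ?f' i (X y0) * (u \<bullet> i))) (at 0)"
    unfolding has_field_derivative_def
  proof (rule has_derivative_transform_within_open[OF sum[unfolded has_field_derivative_def]])
    have cont: "continuous_on UNIV (\<lambda>s::real. (s, y0))" by (intro continuous_intros)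
    show "open ((\<lambda>s. (s, y0)) -` W)" by (rule open_vimage[OF W(1) cont])
    show "0 \<in> (\<lambda>s. (s, y0)) -` W" using W2 by simp
    fix s assume "s \<in> (\<lambda>s. (s, y0)) -` W"
    then have s: "(s, y0) \<in> W" by simp
    have "\<phi> s q \<in> fst C" "g (s, y0) = snd C (\<phi> s q)"
      using W(4)[OF s] C by (simp_all add: y0_def chart_inv_left)
    then show "(\<Sum>i\<in>Basis. (Q (s, y0) \<bullet> i) * ?f i (g (s, y0))) =
        \<alpha> (\<phi> s q) (pushforward A (\<phi> s) q w)"
      using form_eq_coord[OF pushforward_in_tangent[OF flow_smooth w] C(1)] Q[OF s] by simp
  qed
  moreover have "(\<Sum>i\<in>Basis. (X y0 \<bullet> i) * ?f' i u + (?X' u \<bullet> i) * ?f i y0) = 0"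
  proof -
    have "((\<lambda>y. \<Sum>i\<in>Basis. (X y \<bullet> i) * ?f i y) has_derivative
        (\<lambda>h. \<Sum>i\<in>Basis. (X y0 \<bullet> i) * ?f' i h + (?X' h \<bullet> i) * ?f i y0)) (at y0)"
      by (intro has_derivative_sum has_derivative_mult has_derivative_inner_left dX df)
    then have "((\<lambda>y. 1::real) has_derivative
        (\<lambda>h. \<Sum>i\<in>Basis. (X y0 \<bullet> i) * ?f' i h + (?X' h \<bullet> i) * ?f i y0)) (at y0)"
    proof (rule has_derivative_transform_within_open[OF _ chart_image_open[OF C(1)] y0])
      fix y assume y: "y \<in> chart_image C"
      show "(\<Sum>i\<in>Basis. (X y \<bullet> i) * ?f i y) = 1"
        using form_eq_coord[OF reeb_tangent C(1) chart_inv_in[OF y]] reeb_form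
        by (simp add: X_def chart_inv_right[OF y])
    qed
    from fun_cong[OF has_derivative_unique[OF this has_derivative_const], of u] show ?thesis by simp
  qed
  \<comment> \<open>From d\<alpha>(R, w) = 0: exchanging u and X y0 in the second term of the
    derivative found above turns the whole sum into the derivative of \<alpha>(R) in the direction
    u.\<close>
  moreover have "(\<Sum>i\<in>Basis. (u \<bullet> i) * ?f' i (X y0)) = (\<Sum>i\<in>Basis. (X y0 \<bullet> i) * ?f' i u)"
    using reeb_ext_deriv[OF w] ext_deriv_coord[OF C_def, of "R q" w] C
    by (simp add: u_def X_def y0_def chart_inv_left)
  ultimately show ?thesis
    by (simp add: sum.distrib mult.commute add.commute)
qed

text \<open>By the group law the derivative at time t is the derivative at time 0 for the point
  \<phi> t q and the vector pushed there, so it vanishes for all t.\<close>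

lemma flow_preserves_form:
  assumes w: "w \<in> tangent_space A q"
  shows "\<alpha> (\<phi> t q) (pushforward A (\<phi> t) q w) = \<alpha> q w"
proof -
  define h where "h s = \<alpha> (\<phi> s q) (pushforward A (\<phi> s) q w)" for s
  have "(h has_real_derivative 0) (at t)" for t
  proof -
    have "h (s + t) = \<alpha> (\<phi> s (\<phi> t q)) (pushforward A (\<phi> s) (\<phi> t q) (pushforward A (\<phi> t) q w))" for s
      using pushforward_compose[OF flow_smooth flow_smooth w] by (simp add: h_def flow_add)
    then have "((\<lambda>s. h (s + t)) has_real_derivative 0) (at 0)"
      using flow_form_derivative_at_0[OF pushforward_in_tangent[OF flow_smooth w]] by simp
    then show ?thesis using DERIV_shift[of h 0 0 t] by simp
  qed
  then have "h t = h 0" by (intro DERIV_isconst_all) auto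
  then show ?thesis using pushforward_id[OF w] by (simp add: h_def flow_0)
qed

end

section \<open>Contactomorphism groups\<close>

lemma at_within_unit_interval: "t \<in> {0..1} \<Longrightarrow> at t within {0..1::real} \<noteq> bot"
  by (simp add: trivial_limit_within islimpt_Icc)

text \<open>Time reversal and rescaling are written in this shape below, which accounts for terms
  such as \<open>1 + t * (- 1)\<close> and \<open>0 + s * t\<close>.\<close>

lemma Ck_on_affine: "Ck_on k UNIV (\<lambda>t::real. c + t * d)"
  by (intro Ck_on_add Ck_on_const Ck_on_bounded_linear[OF bounded_linear_mult_left] Ck_on_id open_UNIV)

text \<open>Kept abstract because isotopies occur at two levels: through \<open>Cont\<close> in the
  definition of \<open>Cont0\<close>, and through \<open>Cont0\<close> in the definitions of the
  norms. The identity belongs to a nonempty S as \<open>inv f \<circ> f\<close>.\<close>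

definition diffeo_group ::
  "('a::topological_space, 'e::euclidean_space) chart set \<Rightarrow> ('a \<Rightarrow> 'a) set \<Rightarrow> bool" where
  "diffeo_group A S \<longleftrightarrow> (\<forall>f\<in>S. diffeo A f \<and> inv f \<in> S) \<and> (\<forall>f\<in>S. \<forall>g\<in>S. g \<circ> f \<in> S)"

lemma isotopy_endpointI:
  "smooth_isotopy A S \<Psi> \<Longrightarrow> \<Psi> 1 = f \<Longrightarrow> f \<in> {\<Psi> 1 | \<Psi>. smooth_isotopy A S \<Psi>}"
  by blast

section \<open>Isotopies inside a group of diffeomorphisms\<close>

context atlas_manifold
begin

lemma diffeo_compose: "diffeo A f \<Longrightarrow> diffeo A g \<Longrightarrow> diffeo A (g \<circ> f)"
  unfolding diffeo_def by (auto simp: o_inv_distrib intro: bij_comp smooth_map_compose)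

lemma diffeo_inv: "diffeo A f \<Longrightarrow> diffeo A (inv f)"
  unfolding diffeo_def by (auto simp: inv_inv_eq bij_imp_bij_inv)

lemma diffeo_inv_comp: "diffeo A f \<Longrightarrow> inv f \<circ> f = id" "diffeo A f \<Longrightarrow> f \<circ> inv f = id"
  unfolding diffeo_def by (auto simp: bij_is_inj bij_is_surj surj_iff[symmetric])

lemma pushforward_inv:
  assumes f: "diffeo A f" and v: "v \<in> tangent_space A p"
  shows "pushforward A (inv f) (f p) (pushforward A f p v) = v"
proof -
  have "pushforward A (inv f \<circ> f) p v = pushforward A (inv f) (f p) (pushforward A f p v)"
    by (rule pushforward_compose) (use f v in \<open>auto simp: diffeo_def\<close>)
  then show ?thesis using pushforward_id[OF v] by (simp add: diffeo_inv_comp(1)[OF f])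
qed

lemma isotopy_reverse:
  assumes S: "diffeo_group A S" and \<Psi>: "smooth_isotopy A S \<Psi>"
  shows "smooth_isotopy A S (\<lambda>t. \<Psi> (1 - t) \<circ> inv (\<Psi> 1))"
  unfolding smooth_isotopy_def
proof (intro conjI ballI)
  have fam: "smooth_family A {0..1} \<Psi>" and inS: "\<And>t. t \<in> {0..1} \<Longrightarrow> \<Psi> t \<in> S"
    using \<Psi> by (auto simp: smooth_isotopy_def)
  have 1: "\<Psi> 1 \<in> S" by (rule inS) simp
  then have d: "diffeo A (\<Psi> 1)" "inv (\<Psi> 1) \<in> S" using S by (auto simp: diffeo_group_def)
  then have "smooth_family A {0..1} (\<lambda>_. inv (\<Psi> 1))"
    by (intro smooth_family_const) (simp add: diffeo_def)
  moreover have "smooth_family A {0..1} (\<lambda>t. \<Psi> (1 + t * (- 1)))"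
    by (rule smooth_family_reparam[OF fam Ck_on_affine]) auto
  ultimately show "smooth_family A {0..1} (\<lambda>t. \<Psi> (1 - t) \<circ> inv (\<Psi> 1))"
    using smooth_family_compose by force
  show "\<Psi> (1 - 0) \<circ> inv (\<Psi> 1) = id" using diffeo_inv_comp(2)[OF d(1)] by simp
  show "\<Psi> (1 - t) \<circ> inv (\<Psi> 1) \<in> S" if "t \<in> {0..1}" for t
    using inS[of "1 - t"] that d(2) S by (auto simp: diffeo_group_def)
qed

lemma isotopy_compose:
  assumes "diffeo_group A S" "smooth_isotopy A S \<Psi>" "smooth_isotopy A S \<Phi>"
  shows "smooth_isotopy A S (\<lambda>t. \<Psi> t \<circ> \<Phi> t)"
  using assms by (auto simp: smooth_isotopy_def diffeo_group_def intro: smooth_family_compose)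

text \<open>Inverses are endpoints of reversed isotopies, and products are endpoints of pointwise
  products. With \<open>Cont\<close> for S this makes \<open>Cont0\<close> a group.\<close>

lemma isotopy_endpoints_group:
  assumes S: "diffeo_group A S"
  shows "diffeo_group A {\<Psi> 1 | \<Psi>. smooth_isotopy A S \<Psi>}"
  unfolding diffeo_group_def
proof (intro conjI ballI)
  fix f assume "f \<in> {\<Psi> 1 | \<Psi>. smooth_isotopy A S \<Psi>}"
  then obtain \<Psi> where \<Psi>: "smooth_isotopy A S \<Psi>" "f = \<Psi> 1" by auto
  then have "f \<in> S" by (auto simp: smooth_isotopy_def)
  then show "diffeo A f" using S by (auto simp: diffeo_group_def)
  have "inv f = \<Psi> (1 - 1) \<circ> inv (\<Psi> 1)" using \<Psi> by (simp add: smooth_isotopy_def)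
  then show "inv f \<in> {\<Psi> 1 | \<Psi>. smooth_isotopy A S \<Psi>}"
    using isotopy_endpointI[OF isotopy_reverse[OF S \<Psi>(1)]] by simp
  fix g assume "g \<in> {\<Psi> 1 | \<Psi>. smooth_isotopy A S \<Psi>}"
  then obtain \<Phi> where \<Phi>: "smooth_isotopy A S \<Phi>" "g = \<Phi> 1" by auto
  then show "g \<circ> f \<in> {\<Psi> 1 | \<Psi>. smooth_isotopy A S \<Psi>}"
    using isotopy_endpointI[OF isotopy_compose[OF S \<Phi>(1) \<Psi>(1)]] \<Psi>(2) by simp
qed

text \<open>The time-t map is the endpoint of the isotopy rescaled by t. Hence an isotopy through
  \<open>Cont\<close> is one through \<open>Cont0\<close>, as the norms require.\<close>

lemma isotopy_in_endpoints:
  assumes \<Psi>: "smooth_isotopy A S \<Psi>"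
  shows "smooth_isotopy A {\<Phi> 1 | \<Phi>. smooth_isotopy A S \<Phi>} \<Psi>"
  unfolding smooth_isotopy_def[of A _ \<Psi>]
proof (intro conjI ballI)
  show fam: "smooth_family A {0..1} \<Psi>" and "\<Psi> 0 = id" using \<Psi> by (auto simp: smooth_isotopy_def)
  fix t :: real assume t: "t \<in> {0..1}"
  have st: "0 + s * t \<in> {0..1}" if "s \<in> {0..1}" for s
    using that t by (auto intro: mult_le_one)
  have "smooth_family A {0..1} (\<lambda>s. \<Psi> (0 + s * t))"
    by (rule smooth_family_reparam[OF fam Ck_on_affine]) (use st in blast)
  then have "smooth_isotopy A S (\<lambda>s. \<Psi> (0 + s * t))"
    using \<Psi> st by (auto simp: smooth_isotopy_def)
  then show "\<Psi> t \<in> {\<Phi> 1 | \<Phi>. smooth_isotopy A S \<Phi>}" by (rule isotopy_endpointI) simp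
qed

text \<open>As \<Psi> t is injective, the velocity at time t of the path starting at p can be
  indexed by the point \<Psi> t p, which makes it a time-dependent field.\<close>

lemma ex_generates:
  assumes S: "diffeo_group A S" and \<Psi>: "smooth_isotopy A S \<Psi>"
  shows "\<exists>Y. generates A Y \<Psi>"
proof -
  define Y where "Y t x = (SOME v. has_velocity A {0..1} (\<lambda>s. \<Psi> s (inv (\<Psi> t) x)) t v)" for t x
  have "has_velocity A {0..1} (\<lambda>s. \<Psi> s p) t (Y t (\<Psi> t p))" if t: "t \<in> {0..1}" for t p
  proof -
    have "\<exists>v. has_velocity A {0..1} (\<lambda>s. \<Psi> s p) t v"
      using \<Psi> t at_within_unit_interval[OF t] by (intro ex_velocity) (auto simp: smooth_isotopy_def)
    moreover have "inj (\<Psi> t)"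
      using \<Psi> S t by (auto simp: smooth_isotopy_def diffeo_group_def diffeo_def bij_is_inj)
    ultimately show ?thesis unfolding Y_def by (simp add: someI_ex)
  qed
  then show ?thesis unfolding generates_def by blast
qed

lemma generates_tangent:
  assumes "diffeo_group A S" "smooth_isotopy A S \<Psi>" "generates A Y \<Psi>" "t \<in> {0..1}"
  shows "Y t x \<in> tangent_space A x"
proof -
  have "surj (\<Psi> t)"
    using assms by (auto simp: smooth_isotopy_def diffeo_group_def diffeo_def bij_is_surj)
  then obtain p where "x = \<Psi> t p" by (metis surjD)
  then show ?thesis using assms(3,4) by (auto simp: generates_def has_velocity_def)
qed

lemma generates_reverse:
  assumes "generates A Y \<Psi>"
  shows "generates A (\<lambda>t x C. - Y (1 - t) x C) (\<lambda>t. \<Psi> (1 - t) \<circ> f)"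
  unfolding generates_def
proof (intro ballI allI)
  fix t :: real and p assume t: "t \<in> {0..1}"
  then have "has_velocity A {0..1} (\<lambda>s. \<Psi> s (f p)) (1 - t) (Y (1 - t) (\<Psi> (1 - t) (f p)))"
    using assms by (auto simp: generates_def)
  then have "has_velocity A {0..1} (\<lambda>s. \<Psi> (1 - s) (f p)) t
      (\<lambda>C. (- 1) *\<^sub>R Y (1 - t) (\<Psi> (1 - t) (f p)) C)"
    by (rule has_velocity_reparam) (auto intro!: derivative_eq_intros)
  then show "has_velocity A {0..1} (\<lambda>s. (\<Psi> (1 - s) \<circ> f) p) t
      (\<lambda>C. - Y (1 - t) ((\<Psi> (1 - t) \<circ> f) p) C)"
    by simp
qed

end

section \<open>The contactomorphism group and the Reeb flow in it\<close>

locale contact_reeb = reeb_flow A \<alpha> R \<phi>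
  for A :: "('a::topological_space, 'e::euclidean_space) chart set" and \<alpha> R \<phi> +
  fixes \<xi> \<pi> :: "'a \<Rightarrow> ('a, 'e) tvec set"
  assumes contact: "contact_form_for A \<xi> \<pi> \<alpha>"
begin

lemma xi_eq: "\<xi> p = {v \<in> tangent_space A p. \<alpha> p v = 0}"
  and pi_eq: "\<pi> p = {v \<in> tangent_space A p. \<alpha> p v > 0}"
  using contact unfolding contact_form_for_def by blast+

lemma xi_tangent: "v \<in> \<xi> p \<Longrightarrow> v \<in> tangent_space A p"
  and pi_tangent: "v \<in> \<pi> p \<Longrightarrow> v \<in> tangent_space A p"
  by (simp_all add: xi_eq pi_eq)

lemma Cont_group: "diffeo_group A (Cont A \<xi> \<pi>)"
  unfolding diffeo_group_def
proof (intro conjI ballI)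
  fix f assume f: "f \<in> Cont A \<xi> \<pi>"
  then show df: "diffeo A f" by (simp add: Cont_def)
  \<comment> \<open>Stated for an arbitrary field of subsets \<eta>, so that it serves both the
    hyperplanes \<xi> and the half-spaces \<pi>.\<close>
  have inv_image: "pushforward A (inv f) q ` \<eta> q = \<eta> (inv f q)"
    if \<eta>: "\<And>p. \<eta> p \<subseteq> tangent_space A p" "\<And>p. pushforward A f p ` \<eta> p = \<eta> (f p)" for \<eta> q
  proof -
    have q: "q = f (inv f q)" using df by (simp add: diffeo_def bij_is_surj surj_f_inv_f)
    have "pushforward A (inv f) q ` \<eta> q =
        (\<lambda>v. pushforward A (inv f) (f (inv f q)) (pushforward A f (inv f q) v)) ` \<eta> (inv f q)"
      using \<eta>(2)[of "inv f q"] q by (metis image_image)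
    also have "\<dots> = id ` \<eta> (inv f q)"
      by (rule image_cong[OF refl]) (use \<eta>(1) pushforward_inv[OF df] in auto)
    finally show ?thesis by simp
  qed
  show "inv f \<in> Cont A \<xi> \<pi>"
    unfolding Cont_def
  proof (intro CollectI conjI allI diffeo_inv df)
    show "pushforward A (inv f) p ` \<xi> p = \<xi> (inv f p)" for p
      by (rule inv_image) (use f in \<open>auto simp: Cont_def xi_tangent\<close>)
    show "pushforward A (inv f) p ` \<pi> p = \<pi> (inv f p)" for p
      by (rule inv_image) (use f in \<open>auto simp: Cont_def pi_tangent\<close>)
  qed
  fix g assume g: "g \<in> Cont A \<xi> \<pi>"
  have comp_image: "pushforward A (g \<circ> f) p ` \<eta> p = \<eta> ((g \<circ> f) p)"
    if \<eta>: "\<eta> p \<subseteq> tangent_space A p" "\<And>p. pushforward A f p ` \<eta> p = \<eta> (f p)"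
      "\<And>p. pushforward A g p ` \<eta> p = \<eta> (g p)" for \<eta> p
  proof -
    have "pushforward A (g \<circ> f) p ` \<eta> p =
        (\<lambda>v. pushforward A g (f p) (pushforward A f p v)) ` \<eta> p"
      by (intro image_cong[OF refl] pushforward_compose)
        (use f g \<eta>(1) in \<open>auto simp: Cont_def diffeo_def\<close>)
    then show ?thesis using \<eta>(2)[of p] \<eta>(3)[of "f p"] by (simp add: image_image[symmetric])
  qed
  show "g \<circ> f \<in> Cont A \<xi> \<pi>"
    unfolding Cont_def
  proof (intro CollectI conjI allI diffeo_compose df)
    show "diffeo A g" using g by (simp add: Cont_def)
    show "pushforward A (g \<circ> f) p ` \<xi> p = \<xi> ((g \<circ> f) p)" for p
      by (rule comp_image) (use f g in \<open>auto simp: Cont_def xi_tangent\<close>)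
    show "pushforward A (g \<circ> f) p ` \<pi> p = \<pi> ((g \<circ> f) p)" for p
      by (rule comp_image) (use f g in \<open>auto simp: Cont_def pi_tangent\<close>)
  qed
qed

lemma Cont0_group: "diffeo_group A (Cont0 A \<xi> \<pi>)"
  unfolding Cont0_def by (rule isotopy_endpoints_group[OF Cont_group])

lemma isotopy_Cont0: "smooth_isotopy A (Cont A \<xi> \<pi>) \<Psi> \<Longrightarrow> smooth_isotopy A (Cont0 A \<xi> \<pi>) \<Psi>"
  unfolding Cont0_def by (rule isotopy_in_endpoints)

lemma flow_inverse: "\<phi> t (\<phi> (- t) p) = p" "\<phi> (- t) (\<phi> t p) = p"
  using flow_add[of t "- t"] flow_add[of "- t" t] by (auto simp: flow_0 fun_eq_iff)

lemma flow_inv: "inv (\<phi> t) = \<phi> (- t)"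
  by (rule inv_unique_comp) (simp_all add: fun_eq_iff flow_inverse)

lemma flow_diffeo: "diffeo A (\<phi> t)"
  unfolding diffeo_def flow_inv
  by (auto intro!: flow_smooth o_bij[of "\<phi> (- t)"] simp: fun_eq_iff flow_inverse)

lemma flow_in_Cont: "\<phi> t \<in> Cont A \<xi> \<pi>"
proof -
  \<comment> \<open>Both \<xi> and \<pi> are cut out by a condition P on the value of \<alpha>, so
    invariance of \<alpha> under the flow and its inverse settles both at once.\<close>
  have "pushforward A (\<phi> t) p ` {v \<in> tangent_space A p. P (\<alpha> p v)} =
      {v \<in> tangent_space A (\<phi> t p). P (\<alpha> (\<phi> t p) v)}" for p P
  proof (intro equalityI subsetI)
    fix v assume v: "v \<in> {v \<in> tangent_space A (\<phi> t p). P (\<alpha> (\<phi> t p) v)}"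
    let ?w = "pushforward A (\<phi> (- t)) (\<phi> t p) v"
    have "?w \<in> tangent_space A p" "\<alpha> p ?w = \<alpha> (\<phi> t p) v"
      using pushforward_in_tangent[OF flow_smooth, of v "\<phi> t p" "- t"]
        flow_preserves_form[of v "\<phi> t p" "- t"] v by (auto simp: flow_inverse)
    moreover have "pushforward A (\<phi> t) p ?w = v"
      using pushforward_inv[OF flow_diffeo, of v "\<phi> t p" "- t"] v
      by (simp add: flow_inv flow_inverse)
    ultimately show "v \<in> pushforward A (\<phi> t) p ` {v \<in> tangent_space A p. P (\<alpha> p v)}"
      using v by (intro image_eqI[of _ _ ?w]) auto
  qed (auto simp: flow_preserves_form intro: pushforward_in_tangent[OF flow_smooth])
  from this[of _ "\<lambda>a. a = 0"] this[of _ "\<lambda>a. a > 0"] show ?thesis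
    by (simp add: Cont_def flow_diffeo xi_eq pi_eq)
qed

lemma flow_reparam_isotopy:
  assumes "\<And>k. Ck_on k UNIV a" "a 0 = 0"
  shows "smooth_isotopy A (Cont A \<xi> \<pi>) (\<lambda>t. \<phi> (a t))"
  unfolding smooth_isotopy_def
  using smooth_family_reparam[OF flow_family assms(1)] assms(2) by (auto simp: flow_0 flow_in_Cont)

lemma flow_in_Cont0: "\<phi> t \<in> Cont0 A \<xi> \<pi>"
proof -
  have "smooth_isotopy A (Cont A \<xi> \<pi>) (\<lambda>s. \<phi> (0 + s * t))"
    by (rule flow_reparam_isotopy[OF Ck_on_affine]) simp
  then show ?thesis unfolding Cont0_def by (rule isotopy_endpointI) simp
qed

text \<open>The product rule for the point \<Psi> s p moved by \<phi> (a s). At x = \<phi> (a t)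
  (\<Psi> t p) the moving point is \<phi> (- a t) x, which is where Y is evaluated before being
  pushed forward.\<close>

lemma generates_flow:
  assumes \<Psi>: "smooth_isotopy A (Cont0 A \<xi> \<pi>) \<Psi>" and Y: "generates A Y \<Psi>"
    and a: "\<And>k. Ck_on k UNIV a" "\<And>t. (a has_real_derivative a' t) (at t)"
  shows "generates A (\<lambda>t x D. a' t *\<^sub>R R x D +
      pushforward A (\<phi> (a t)) (\<phi> (- a t) x) (Y t (\<phi> (- a t) x)) D) (\<lambda>t. \<phi> (a t) \<circ> \<Psi> t)"
  unfolding generates_def
proof (intro ballI allI)
  fix t :: real and p assume t: "t \<in> {0..1}"
  have fam: "smooth_family A {0..1} (\<lambda>s. \<phi> (a s))"
    by (rule smooth_family_reparam[OF flow_family a(1)]) auto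
  have cont: "continuous_on {0..1} (\<lambda>s. \<Psi> s p)"
    using \<Psi> by (auto simp: smooth_isotopy_def intro: smooth_family_curve_cont)
  have w: "has_velocity A {0..1} (\<lambda>s. \<phi> (a s) (\<Psi> t p)) t
      (\<lambda>C. a' t *\<^sub>R R (\<phi> (a t) (\<Psi> t p)) C)"
    by (rule has_velocity_reparam[where c = "\<lambda>s. \<phi> s (\<Psi> t p)", OF flow_velocity])
      (auto intro: has_field_derivative_at_within a(2))
  have v: "has_velocity A {0..1} (\<lambda>s. \<Psi> s p) t (Y t (\<Psi> t p))"
    using Y t by (auto simp: generates_def)
  from has_velocity_family_curve[OF fam cont t at_within_unit_interval[OF t] w v]
  show "has_velocity A {0..1} (\<lambda>s. (\<phi> (a s) \<circ> \<Psi> s) p) t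
      (\<lambda>D. a' t *\<^sub>R R ((\<phi> (a t) \<circ> \<Psi> t) p) D +
        pushforward A (\<phi> (a t)) (\<phi> (- a t) ((\<phi> (a t) \<circ> \<Psi> t) p))
          (Y t (\<phi> (- a t) ((\<phi> (a t) \<circ> \<Psi> t) p))) D)"
    by (simp add: flow_inverse)
qed

section \<open>Contact Hamiltonians\<close>

text \<open>Both norms are infima over these Hamiltonians, so the isotopy and its field can be
  hidden. Outside [0,1] the field Y is unconstrained, and so is H; statements about H are therefore
  restricted to t in [0,1].\<close>

definition hamiltonian_path :: "('a \<Rightarrow> 'a) \<Rightarrow> (real \<Rightarrow> 'a \<Rightarrow> real) \<Rightarrow> bool" where
  "hamiltonian_path \<psi> H \<longleftrightarrow> (\<exists>\<Psi> Y. smooth_isotopy A (Cont0 A \<xi> \<pi>) \<Psi> \<and> generates A Y \<Psi> \<and> \<Psi> 1 = \<psi> \<and>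
     H = (\<lambda>t x. \<alpha> x (Y t x)))"

lemma ex_hamiltonian_path:
  assumes "\<psi> \<in> Cont0 A \<xi> \<pi>"
  shows "\<exists>H. hamiltonian_path \<psi> H"
proof -
  obtain \<Psi> where "smooth_isotopy A (Cont A \<xi> \<pi>) \<Psi>" "\<Psi> 1 = \<psi>"
    using assms unfolding Cont0_def by auto
  then show ?thesis
    using isotopy_Cont0 ex_generates[OF Cont_group] unfolding hamiltonian_path_def by blast
qed

lemma hamiltonian_path_reverse:
  assumes "hamiltonian_path \<psi> H"
  obtains H' where "hamiltonian_path (inv \<psi>) H'" "\<And>t x. t \<in> {0..1} \<Longrightarrow> H' t x = - H (1 - t) x"
proof -
  obtain \<Psi> Y where \<Psi>: "smooth_isotopy A (Cont0 A \<xi> \<pi>) \<Psi>" and Y: "generates A Y \<Psi>"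
    and \<psi>: "\<Psi> 1 = \<psi>" and H: "H = (\<lambda>t x. \<alpha> x (Y t x))"
    using assms unfolding hamiltonian_path_def by auto
  define Y' where "Y' t x C = - Y (1 - t) x C" for t x C
  show thesis
  proof
    have "smooth_isotopy A (Cont0 A \<xi> \<pi>) (\<lambda>t. \<Psi> (1 - t) \<circ> inv (\<Psi> 1))"
      by (rule isotopy_reverse[OF Cont0_group \<Psi>])
    moreover have "generates A Y' (\<lambda>t. \<Psi> (1 - t) \<circ> inv (\<Psi> 1))"
      unfolding Y'_def[abs_def] by (rule generates_reverse[OF Y])
    moreover have "\<Psi> (1 - 1) \<circ> inv (\<Psi> 1) = inv \<psi>" using \<Psi> \<psi> by (simp add: smooth_isotopy_def)
    ultimately show "hamiltonian_path (inv \<psi>) (\<lambda>t x. \<alpha> x (Y' t x))"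
      unfolding hamiltonian_path_def by blast
    show "\<alpha> x (Y' t x) = - H (1 - t) x" if "t \<in> {0..1}" for t x
      using form_uminus[OF generates_tangent[OF Cont0_group \<Psi> Y, of "1 - t" x]] that
      by (simp add: H Y'_def[abs_def])
  qed
qed

lemma hamiltonian_path_flow:
  assumes "hamiltonian_path \<psi> H"
    and a: "\<And>k. Ck_on k UNIV a" "\<And>t. (a has_real_derivative a' t) (at t)" "a 0 = 0"
  obtains H' where "hamiltonian_path (\<phi> (a 1) \<circ> \<psi>) H'"
    "\<And>t x. t \<in> {0..1} \<Longrightarrow> H' t x = a' t + H t (\<phi> (- a t) x)"
proof -
  obtain \<Psi> Y where \<Psi>: "smooth_isotopy A (Cont0 A \<xi> \<pi>) \<Psi>" and Y: "generates A Y \<Psi>"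
    and \<psi>: "\<Psi> 1 = \<psi>" and H: "H = (\<lambda>t x. \<alpha> x (Y t x))"
    using assms unfolding hamiltonian_path_def by auto
  define Y' where "Y' t x D = a' t *\<^sub>R R x D +
      pushforward A (\<phi> (a t)) (\<phi> (- a t) x) (Y t (\<phi> (- a t) x)) D" for t x D
  show thesis
  proof
    have "smooth_isotopy A (Cont0 A \<xi> \<pi>) (\<lambda>t. \<phi> (a t) \<circ> \<Psi> t)"
      by (rule isotopy_compose[OF Cont0_group isotopy_Cont0[OF flow_reparam_isotopy[OF a(1,3)]] \<Psi>])
    moreover have "generates A Y' (\<lambda>t. \<phi> (a t) \<circ> \<Psi> t)"
      unfolding Y'_def[abs_def] by (rule generates_flow[OF \<Psi> Y a(1,2)])
    ultimately show "hamiltonian_path (\<phi> (a 1) \<circ> \<psi>) (\<lambda>t x. \<alpha> x (Y' t x))"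
      unfolding hamiltonian_path_def using \<psi> by blast
    fix t x assume t: "t \<in> {0..1::real}"
    let ?x = "\<phi> (- a t) x" and ?w = "pushforward A (\<phi> (a t)) (\<phi> (- a t) x) (Y t (\<phi> (- a t) x))"
    have T: "Y t ?x \<in> tangent_space A ?x" by (rule generates_tangent[OF Cont0_group \<Psi> Y t])
    have "?w \<in> tangent_space A x"
      using pushforward_in_tangent[OF flow_smooth T, of "a t"] by (simp add: flow_inverse)
    then have "\<alpha> x (Y' t x) = a' t * \<alpha> x (R x) + \<alpha> x ?w"
      using form_lincomb[OF reeb_tangent, of ?w x "a' t" 1] by (simp add: Y'_def[abs_def])
    moreover have "\<alpha> x ?w = H t ?x"
      using flow_preserves_form[OF T, of "a t"] by (simp add: flow_inverse H)
    ultimately show "\<alpha> x (Y' t x) = a' t + H t ?x" by (simp add: reeb_form)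
  qed
qed

text \<open>Along the moving point \<Psi> t p the generating field is the time derivative of a local
  extension, hence continuous in (t, p). At a fixed point x it would involve how
  \<open>inv (\<Psi> t) x\<close> depends on t.\<close>

lemma hamiltonian_continuous:
  assumes \<Psi>: "smooth_isotopy A (Cont0 A \<xi> \<pi>) \<Psi>" and Y: "generates A Y \<Psi>"
  shows "continuous_on ({0..1} \<times> UNIV) (\<lambda>(t, p). \<alpha> (\<Psi> t p) (Y t (\<Psi> t p)))"
  unfolding continuous_on_def
proof
  fix z :: "real \<times> 'a" assume "z \<in> {0..1} \<times> UNIV"
  then obtain t p where z: "z = (t, p)" and t: "t \<in> {0..1}" by auto
  have fam: "smooth_family A {0..1} \<Psi>" using \<Psi> by (simp add: smooth_isotopy_def)
  obtain C where C: "C \<in> A" "p \<in> fst C" using ex_chart by blast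
  obtain D where D: "D \<in> A" "\<Psi> t p \<in> fst D" using ex_chart by blast
  obtain W g where W: "open W" "(t, snd C p) \<in> W" "\<And>k. Ck_on k W g"
    "\<And>s y. (s, y) \<in> W \<Longrightarrow> s \<in> {0..1} \<Longrightarrow>
      y \<in> chart_image C \<and> \<Psi> s (chart_inv C y) \<in> fst D \<and> g (s, y) = snd D (\<Psi> s (chart_inv C y))"
    by (rule smooth_family_local_extension[OF fam t C D]) blast
  have Wg: "\<And>s y. (s, y) \<in> W \<Longrightarrow> s \<in> {0..1} \<Longrightarrow> g (s, y) = snd D (\<Psi> s (chart_inv C y))"
    using W(4) by blast
  define c where "c z = (fst z, snd C (snd z))" for z :: "real \<times> 'a"
  define N where "N = c -` W \<inter> (UNIV \<times> fst C)"
  have c: "continuous_on (UNIV \<times> fst C) c" unfolding c_def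
    by (intro continuous_intros continuous_on_compose2[OF chart_cont[OF C(1)]]) auto
  have "open (UNIV \<times> fst C :: (real \<times> 'a) set)" by (intro open_Times open_UNIV chart_open C)
  with c W(1) have N: "open N" unfolding N_def by (metis continuous_on_open_vimage)
  have zN: "z \<in> N" using W(2) C by (auto simp: N_def z c_def)
  let ?I = "{0..1} \<times> (UNIV :: 'a set)"
  let ?h = "\<lambda>(t, p). \<alpha> (\<Psi> t p) (Y t (\<Psi> t p))"
  let ?g1 = "\<lambda>z. frechet_derivative g (at z) (1, 0)"
  have "continuous_on (N \<inter> ?I) (\<lambda>z. \<Sum>i\<in>Basis. (?g1 (c z) \<bullet> i) * form_coord D i (g (c z)))"
  proof (intro continuous_on_sum continuous_on_mult continuous_on_inner continuous_on_const)
    have cN: "continuous_on (N \<inter> ?I) c" by (rule continuous_on_subset[OF c]) (auto simp: N_def)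
    have "continuous_on W ?g1" using W(3)[of 1] by simp
    then show "continuous_on (N \<inter> ?I) (\<lambda>z. ?g1 (c z))"
      by (rule continuous_on_compose2[OF _ cN]) (auto simp: N_def)
    fix i
    have gc: "continuous_on (N \<inter> ?I) (\<lambda>z. g (c z))"
      by (rule continuous_on_compose2[OF _ cN, of W g]) (use W(3)[of 0] in \<open>auto simp: N_def\<close>)
    have "continuous_on (chart_image D) (form_coord D i)"
      using form_coord_Ck[OF D(1), of 0 i] by simp
    then show "continuous_on (N \<inter> ?I) (\<lambda>z. form_coord D i (g (c z)))"
      by (rule continuous_on_compose2[OF _ gc])
        (use W(4) in \<open>auto simp: N_def c_def chart_in_image\<close>)
  qed
  moreover have "(\<Sum>i\<in>Basis. (?g1 (c x) \<bullet> i) * form_coord D i (g (c x))) = ?h x" if "x \<in> N \<inter> ?I" for x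
  proof -
    obtain s q where x: "x = (s, q)" by (cases x)
    have s: "s \<in> {0..1}" and q: "q \<in> fst C" and sq: "(s, snd C q) \<in> W"
      using that by (auto simp: x N_def c_def)
    have D': "\<Psi> s q \<in> fst D" "g (s, snd C q) = snd D (\<Psi> s q)"
      using W(4)[OF sq s] by (auto simp: chart_inv_left[OF C(1) q])
    have v: "has_velocity A {0..1} (\<lambda>s. \<Psi> s q) s (Y s (\<Psi> s q))"
      using Y s by (auto simp: generates_def)
    have 1: "((\<lambda>s. snd D (\<Psi> s q)) has_vector_derivative frechet_derivative g (at (s, snd C q)) (1, 0))
        (at s within {0..1})"
      by (rule family_curve_derivative[where c = "\<lambda>_. q" and F = \<Psi>, OF _ s C(1) q _ W(1) sq W(3) Wg])
        (auto intro: continuous_on_const)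
    have 2: "((\<lambda>s. snd D (\<Psi> s q)) has_vector_derivative Y s (\<Psi> s q) D) (at s within {0..1})"
      using v D(1) D'(1) by (auto simp: has_velocity_def)
    have "?g1 (c x) = Y s (\<Psi> s q) D"
      using vector_derivative_within[OF at_within_unit_interval[OF s] 1]
        vector_derivative_within[OF at_within_unit_interval[OF s] 2] by (simp add: c_def x)
    moreover have "Y s (\<Psi> s q) \<in> tangent_space A (\<Psi> s q)" using v by (simp add: has_velocity_def)
    from form_eq_coord[OF this D(1) D'(1)]
    have "?h x = (\<Sum>i\<in>Basis. (Y s (\<Psi> s q) D \<bullet> i) * form_coord D i (snd D (\<Psi> s q)))"
      by (simp add: x)
    ultimately show ?thesis using D'(2) by (simp add: x c_def)
  qed
  ultimately have "continuous_on (N \<inter> ?I) ?h" by (subst continuous_on_cong[OF refl, symmetric])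
  then have "(?h \<longlongrightarrow> ?h z) (at z within (N \<inter> ?I))"
    using zN t unfolding continuous_on_def by (elim ballE[of _ _ z]) (auto simp: z)
  moreover have "at z within (N \<inter> ?I) = at z within ?I"
    by (rule at_within_nhd[OF zN N]) auto
  ultimately show "(?h \<longlongrightarrow> ?h z) (at z within ?I)" by simp
qed

end

section \<open>Fibrewise suprema and polynomial primitives\<close>

lemma compact_UNIV_bdd:
  fixes f :: "'a::topological_space \<Rightarrow> real"
  assumes "compact (UNIV :: 'a set)" "continuous_on UNIV f"
  shows "bdd_above (range f)" "bdd_below (range f)"
  using compact_imp_bounded[OF compact_continuous_image[OF assms(2,1)]]
  by (auto intro: bounded_imp_bdd_above bounded_imp_bdd_below)

text \<open>Compactness makes continuity in t uniform in p, and suprema of functions within e / 2 of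
  each other differ by at most e / 2.\<close>

lemma continuous_on_SUP_fibre:
  fixes f :: "'a::topological_space \<Rightarrow> 'b::topological_space \<Rightarrow> real"
  assumes K: "compact (UNIV :: 'b set)" and f: "continuous_on (I \<times> UNIV) (\<lambda>(t, p). f t p)"
  shows "continuous_on I (\<lambda>t. SUP p. f t p)"
proof -
  have bdd: "bdd_above (range (f t))" if "t \<in> I" for t
  proof (rule compact_UNIV_bdd(1)[OF K])
    have "continuous_on UNIV (\<lambda>p. (\<lambda>(t, p). f t p) (t, p))"
      using that by (intro continuous_on_compose2[OF f]) (auto intro!: continuous_intros)
    then show "continuous_on UNIV (f t)" by simp
  qed
  have le: "(SUP p. f s p) \<le> (SUP p. f t p) + e"
    if "t \<in> I" "\<And>p. \<bar>f s p - f t p\<bar> \<le> e" for s t e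
  proof (rule cSUP_least)
    fix p
    have "f t p \<le> (SUP p. f t p)" using bdd[OF that(1)] by (intro cSUP_upper) auto
    then show "f s p \<le> (SUP p. f t p) + e" using that(2)[of p] by linarith
  qed simp
  show ?thesis
    unfolding continuous_on_def tendsto_iff
  proof (intro ballI allI impI)
    fix t and e :: real assume t: "t \<in> I" and e: "e > 0"
    obtain X where X: "t \<in> X" "open X"
      "\<forall>s\<in>X \<inter> I. \<forall>p\<in>UNIV. dist ((\<lambda>(t, p). f t p) (s, p)) ((\<lambda>(t, p). f t p) (t, p)) \<le> e / 2"
      by (rule continuous_on_prod_compactE[OF f K t half_gt_zero[OF e]])
    have "dist (SUP p. f s p) (SUP p. f t p) < e" if s: "s \<in> X" "s \<in> I" for s
    proof -
      have d: "\<bar>f s p - f t p\<bar> \<le> e / 2" for p using X(3) s by (auto simp: dist_real_def)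
      have d': "\<bar>f t p - f s p\<bar> \<le> e / 2" for p using d[of p] by (simp add: abs_minus_commute)
      show ?thesis using le[OF t d] le[OF s(2) d'] e by (simp add: dist_real_def)
    qed
    then show "\<forall>\<^sub>F s in at t within I. dist (SUP p. f s p) (SUP p. f t p) < e"
      using X(1,2) unfolding eventually_at_topological by blast
  qed
qed

lemma Ck_on_power: "Ck_on k UNIV (\<lambda>t::real. t ^ n)"
proof (induction n)
  case (Suc n)
  show ?case unfolding power_Suc
    by (rule Ck_on_bounded_bilinear[OF bounded_bilinear_mult open_UNIV Ck_on_id Suc])
qed (simp add: Ck_on_const)

text \<open>Termwise integration. The primitive is smooth on the whole line and vanishes at 0, so it
  reparametrizes the Reeb flow to a smooth isotopy starting at the identity.\<close>

lemma real_polynomial_function_primitive: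
  assumes "real_polynomial_function (p :: real \<Rightarrow> real)"
  obtains a where "\<And>k. Ck_on k UNIV a" "\<And>t. (a has_real_derivative p t) (at t)" "a 0 = 0"
proof -
  obtain b n where p: "p = (\<lambda>t. \<Sum>i\<le>n. b i * t ^ i)"
    using assms real_polynomial_function_iff_sum by auto
  define a where "a t = (\<Sum>i\<le>n. (b i / real (Suc i)) * t ^ Suc i)" for t
  show thesis
  proof
    show "Ck_on k UNIV a" for k unfolding a_def
      by (intro Ck_on_sum open_UNIV Ck_on_bounded_linear[OF bounded_linear_mult_right] Ck_on_power)
    show "(a has_real_derivative p t) (at t)" for t
      unfolding a_def p
    proof (rule DERIV_sum)
      fix i
      have "((\<lambda>t. t ^ Suc i) has_real_derivative real (Suc i) * t ^ i) (at t)"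
        using DERIV_pow[of "Suc i" t] by simp
      from DERIV_cmult[OF this, of "b i / real (Suc i)"]
      show "((\<lambda>t. b i / real (Suc i) * t ^ Suc i) has_real_derivative b i * t ^ i) (at t)"
        by (simp del: of_nat_Suc power_Suc)
    qed
    show "a 0 = 0" by (simp add: a_def)
  qed
qed

lemma integral_reverse_unit_interval:
  fixes f :: "real \<Rightarrow> real"
  shows "integral {0..1} (\<lambda>t. f (1 - t)) = integral {0..1} f"
proof -
  have "integral {0..1} (\<lambda>t. f (1 - t)) = integral {-1..0} (\<lambda>t. f (1 + t))"
    using Henstock_Kurzweil_Integration.integral_reflect_real[of 0 "-1" "\<lambda>t. f (1 + t)"] by simp
  also have "\<dots> = integral {0..1} f"
    using integral_shift_real_ivl[of 0 1 1 f] by (simp add: add.commute)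
  finally show ?thesis .
qed

section \<open>Comparison of the two norms\<close>

locale closed_contact_reeb = contact_reeb A \<alpha> R \<phi> \<xi> \<pi>
  for A :: "('a::topological_space, 'e::euclidean_space) chart set" and \<alpha> R \<phi> \<xi> \<pi> +
  assumes compact_UNIV: "compact (UNIV :: 'a set)"
begin

definition oscillation :: "(real \<Rightarrow> 'a \<Rightarrow> real) \<Rightarrow> real \<Rightarrow> real" where
  "oscillation H t = (SUP x. H t x) - (INF x. H t x)"

lemma contact_norm_eq:
  "contact_norm A \<xi> \<pi> \<alpha> \<psi> = Inf {integral {0..1} (\<lambda>t. SUP x. \<bar>H t x\<bar>) | H. hamiltonian_path \<psi> H}"
  unfolding contact_norm_def hamiltonian_path_def
  by (intro arg_cong[where f = Inf] Collect_cong) fastforce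

lemma contact_osc_norm_eq:
  "contact_osc_norm A \<xi> \<pi> \<alpha> \<psi> = Inf {integral {0..1} (oscillation H) | H. hamiltonian_path \<psi> H}"
  unfolding contact_osc_norm_def hamiltonian_path_def oscillation_def[abs_def]
  by (intro arg_cong[where f = Inf] Collect_cong) fastforce

text \<open>Composing with the bijections \<open>\<Psi> t\<close> does not change fibrewise suprema, so it suffices that
  \<open>H t (\<Psi> t p)\<close> is continuous in \<open>(t, p)\<close>.\<close>

lemma hamiltonian_path_range:
  assumes "hamiltonian_path \<psi> H"
  obtains h where "continuous_on ({0..1} \<times> UNIV) (\<lambda>(t, p :: 'a). h t p)"
    "\<And>t. t \<in> {0..1} \<Longrightarrow> range (H t) = range (h t)"
proof -
  obtain \<Psi> Y where \<Psi>: "smooth_isotopy A (Cont0 A \<xi> \<pi>) \<Psi>" and Y: "generates A Y \<Psi>"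
    and H: "H = (\<lambda>t x. \<alpha> x (Y t x))"
    using assms unfolding hamiltonian_path_def by auto
  show thesis
  proof
    show "continuous_on ({0..1} \<times> UNIV) (\<lambda>(t, p). H t (\<Psi> t p))"
      using hamiltonian_continuous[OF \<Psi> Y] by (simp add: H)
    fix t :: real assume "t \<in> {0..1}"
    then have "surj (\<Psi> t)"
      using \<Psi> Cont0_group by (auto simp: smooth_isotopy_def diffeo_group_def diffeo_def bij_is_surj)
    then have "range (H t) = H t ` \<Psi> t ` UNIV" by simp
    then show "range (H t) = range (\<lambda>p. H t (\<Psi> t p))" by (simp only: image_image)
  qed
qed

text \<open>Suprema and infima of reals are informative only for bounded sets; the estimates below
  rely on these bounds.\<close>

lemma hamiltonian_bdd:
  assumes "hamiltonian_path \<psi> H" "t \<in> {0..1}"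
  shows "bdd_above (range (H t))" "bdd_below (range (H t))" "bdd_above (range (\<lambda>x. \<bar>H t x\<bar>))"
proof -
  obtain h where h: "continuous_on ({0..1} \<times> UNIV) (\<lambda>(t, p :: 'a). h t p)"
    and r: "range (H t) = range (h t)"
    using hamiltonian_path_range[OF assms(1)] assms(2) by metis
  have "continuous_on UNIV (\<lambda>p. (\<lambda>(t, p). h t p) (t, p))"
    using assms(2) by (intro continuous_on_compose2[OF h]) (auto intro!: continuous_intros)
  then have c: "continuous_on UNIV (h t)" by simp
  show "bdd_above (range (H t))" "bdd_below (range (H t))"
    unfolding r using compact_UNIV_bdd[OF compact_UNIV c] by auto
  have "range (\<lambda>x. \<bar>H t x\<bar>) = abs ` range (H t)" by auto
  also have "\<dots> = range (\<lambda>x. \<bar>h t x\<bar>)" unfolding r by auto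
  finally show "bdd_above (range (\<lambda>x. \<bar>H t x\<bar>))"
    using compact_UNIV_bdd(1)[OF compact_UNIV continuous_on_rabs[OF c]] by simp
qed

lemma hamiltonian_sup_continuous:
  assumes "hamiltonian_path \<psi> H"
  shows "continuous_on {0..1} (\<lambda>t. SUP x. H t x)" "continuous_on {0..1} (\<lambda>t. INF x. H t x)"
    "continuous_on {0..1} (\<lambda>t. SUP x. \<bar>H t x\<bar>)"
proof -
  obtain h where h: "continuous_on ({0..1} \<times> UNIV) (\<lambda>(t, p :: 'a). h t p)"
    and r: "\<And>t. t \<in> {0..1} \<Longrightarrow> range (H t) = range (h t)"
    using hamiltonian_path_range[OF assms] by metis
  \<comment> \<open>The three claims use the identity, the absolute value and negation for g; the
    infimum is minus the supremum of the negated function.\<close>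
  have S: "continuous_on {0..1} (\<lambda>t. SUP p. g (h t p))"
    if g: "continuous_on UNIV g" for g :: "real \<Rightarrow> real"
  proof (rule continuous_on_SUP_fibre[OF compact_UNIV])
    show "continuous_on ({0..1} \<times> UNIV) (\<lambda>(t, p). g (h t p))"
      using continuous_on_compose2[OF g h] by (simp add: case_prod_unfold)
  qed
  have eq: "(\<lambda>x. g (H t x)) ` UNIV = (\<lambda>x. g (h t x)) ` UNIV" if "t \<in> {0..1}" for t and g :: "real \<Rightarrow> real"
    using r[OF that] by (metis image_image)
  show "continuous_on {0..1} (\<lambda>t. SUP x. H t x)"
    by (rule continuous_on_eq[OF S[OF continuous_on_id]]) (simp add: r)
  show "continuous_on {0..1} (\<lambda>t. SUP x. \<bar>H t x\<bar>)"
    by (rule continuous_on_eq[OF S[OF continuous_on_rabs[OF continuous_on_id]]]) (simp only: eq[of _ abs])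
  have "continuous_on {0..1} (\<lambda>t. - (SUP p. - h t p))"
    by (intro continuous_on_minus S continuous_on_id)
  moreover have "- (SUP p. - h t p) = (INF x. H t x)" if "t \<in> {0..1}" for t
    using eq[OF that, of uminus] by (simp add: Inf_real_def image_image)
  ultimately show "continuous_on {0..1} (\<lambda>t. INF x. H t x)"
    by (rule continuous_on_eq)
qed

lemma hamiltonian_integrable:
  assumes "hamiltonian_path \<psi> H"
  shows "(\<lambda>t. SUP x. \<bar>H t x\<bar>) integrable_on {0..1}" "oscillation H integrable_on {0..1}"
  unfolding oscillation_def[abs_def]
  by (intro integrable_continuous_real continuous_on_diff hamiltonian_sup_continuous[OF assms])+

lemma hamiltonian_bounds:
  assumes "hamiltonian_path \<psi> H" "t \<in> {0..1}"
  shows "H t x \<le> (SUP x. H t x)" "(INF x. H t x) \<le> H t x" "\<bar>H t x\<bar> \<le> (SUP x. \<bar>H t x\<bar>)"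
  using hamiltonian_bdd[OF assms] by (auto intro: cSUP_upper cINF_lower)

text \<open>Supplies the lower bound 0 that estimates with \<open>Inf\<close> on the reals
  require.\<close>

lemma contact_norm_integral_nonneg:
  assumes "hamiltonian_path \<psi> H"
  shows "0 \<le> integral {0..1} (\<lambda>t. SUP x. \<bar>H t x\<bar>)"
proof (rule integral_nonneg[OF hamiltonian_integrable(1)[OF assms]])
  show "0 \<le> (SUP x. \<bar>H t x\<bar>)" if "t \<in> {0..1}" for t
    using hamiltonian_bounds(3)[OF assms that] abs_ge_zero order_trans by blast
qed

lemma osc_norm_integral_nonneg:
  assumes "hamiltonian_path \<psi> H"
  shows "0 \<le> integral {0..1} (oscillation H)"
proof (rule integral_nonneg[OF hamiltonian_integrable(2)[OF assms]])
  show "0 \<le> oscillation H t" if "t \<in> {0..1}" for t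
    using hamiltonian_bounds(1,2)[OF assms that] unfolding oscillation_def
    by (meson diff_ge_0_iff_ge order_trans)
qed

text \<open>Negation exchanges supremum and infimum up to sign, which preserves their difference,
  and time reversal preserves the integral. So the oscillation norm does not distinguish \<psi> from
  its inverse.\<close>

lemma oscillation_reverse:
  assumes "hamiltonian_path \<psi> H"
  obtains H' where "hamiltonian_path (inv \<psi>) H'"
    "integral {0..1} (oscillation H') = integral {0..1} (oscillation H)"
proof -
  obtain H' where H': "hamiltonian_path (inv \<psi>) H'" "\<And>t x. t \<in> {0..1} \<Longrightarrow> H' t x = - H (1 - t) x"
    using hamiltonian_path_reverse[OF assms] by blast
  have "oscillation H' t = oscillation H (1 - t)" if "t \<in> {0..1}" for t
    using H'(2)[OF that] by (simp add: oscillation_def Inf_real_def image_image)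
  then have "integral {0..1} (oscillation H') = integral {0..1} (\<lambda>t. oscillation H (1 - t))"
    by (intro integral_cong) auto
  then show thesis using that[OF H'(1)] integral_reverse_unit_interval[of "oscillation H"] by simp
qed

text \<open>Adding c t centres the range of H t at 0, leaving half the oscillation as bound for the
  absolute value, and p differs from c by less than e. The endpoint moves by the Reeb time a 1,
  which depends on H and e; hence the existential s here and the infimum over Reeb times in the
  theorem.\<close>

lemma contact_norm_le_half_oscillation:
  assumes H: "hamiltonian_path \<psi> H" and e: "0 < e"
  shows "\<exists>s K. hamiltonian_path (\<phi> s \<circ> \<psi>) K \<and>
    integral {0..1} (\<lambda>t. SUP x. \<bar>K t x\<bar>) \<le> integral {0..1} (oscillation H) / 2 + e"
proof -
  define c where "c t = - ((SUP x. H t x) + (INF x. H t x)) / 2" for t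
  have "continuous_on {0..1} c" unfolding c_def
    by (intro continuous_intros hamiltonian_sup_continuous[OF H]) simp
  then obtain p where p: "real_polynomial_function p" "\<And>t. t \<in> {0..1} \<Longrightarrow> \<bar>c t - p t\<bar> < e"
    using Stone_Weierstrass_real_polynomial_function[of "{0..1}" c e] e by auto
  obtain a where a: "\<And>k. Ck_on k UNIV a" "\<And>t. (a has_real_derivative p t) (at t)" "a 0 = 0"
    by (rule real_polynomial_function_primitive[OF p(1)]) blast
  obtain K where K: "hamiltonian_path (\<phi> (a 1) \<circ> \<psi>) K"
    "\<And>t x. t \<in> {0..1} \<Longrightarrow> K t x = p t + H t (\<phi> (- a t) x)"
    by (rule hamiltonian_path_flow[OF H a]) blast
  have "integral {0..1} (\<lambda>t. SUP x. \<bar>K t x\<bar>) \<le> integral {0..1} (\<lambda>t. oscillation H t / 2 + e)"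
  proof (rule integral_le[OF hamiltonian_integrable(1)[OF K(1)]])
    show "(\<lambda>t. oscillation H t / 2 + e) integrable_on {0..1}"
      by (intro integrable_add integrable_const_ivl) (simp add: hamiltonian_integrable[OF H])
    fix t :: real assume t: "t \<in> {0..1}"
    show "(SUP x. \<bar>K t x\<bar>) \<le> oscillation H t / 2 + e"
    proof (rule cSUP_least)
      fix x
      show "\<bar>K t x\<bar> \<le> oscillation H t / 2 + e"
        using p(2)[OF t] hamiltonian_bounds(1,2)[OF H t, of "\<phi> (- a t) x"]
        unfolding K(2)[OF t] c_def oscillation_def abs_less_iff abs_le_iff by argo
    qed simp
  qed
  also have "\<dots> = integral {0..1} (oscillation H) / 2 + e"
    by (subst integral_add) (simp_all add: hamiltonian_integrable[OF H] integrable_const_ivl)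
  finally show ?thesis using K(1) by blast
qed

lemma half_oscillation_le_contact_norm:
  assumes K: "hamiltonian_path (\<phi> s \<circ> \<psi>) K"
  shows "\<exists>H. hamiltonian_path \<psi> H \<and>
    integral {0..1} (oscillation H) \<le> 2 * integral {0..1} (\<lambda>t. SUP x. \<bar>K t x\<bar>)"
proof -
  define a where "a t = 0 + t * (- s)" for t
  have a: "\<And>k. Ck_on k UNIV a" "\<And>t. (a has_real_derivative - s) (at t)" "a 0 = 0"
    unfolding a_def by (rule Ck_on_affine) (auto intro!: derivative_eq_intros)
  obtain H where H: "hamiltonian_path (\<phi> (a 1) \<circ> (\<phi> s \<circ> \<psi>)) H"
    "\<And>t x. t \<in> {0..1} \<Longrightarrow> H t x = - s + K t (\<phi> (- a t) x)"
    by (rule hamiltonian_path_flow[OF K a]) blast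
  have "\<phi> (a 1) \<circ> (\<phi> s \<circ> \<psi>) = \<psi>" by (auto simp: a_def fun_eq_iff flow_inverse)
  with H(1) have H1: "hamiltonian_path \<psi> H" by simp
  have "integral {0..1} (oscillation H) \<le> integral {0..1} (\<lambda>t. 2 * (SUP x. \<bar>K t x\<bar>))"
  proof (rule integral_le[OF hamiltonian_integrable(2)[OF H1]])
    show "(\<lambda>t. 2 * (SUP x. \<bar>K t x\<bar>)) integrable_on {0..1}"
      by (intro integrable_on_mult_right hamiltonian_integrable[OF K])
    fix t :: real assume t: "t \<in> {0..1}"
    \<comment> \<open>With M the supremum of |K t|, the function H t + s takes values between -M and
      M, so the range of H t has length at most 2 * M, whatever s is.\<close>
    have b: "- (SUP x. \<bar>K t x\<bar>) \<le> H t x + s" "H t x + s \<le> (SUP x. \<bar>K t x\<bar>)" for x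
      using hamiltonian_bounds(3)[OF K t, of "\<phi> (- a t) x"] unfolding H(2)[OF t] by auto
    have "(SUP x. H t x) \<le> (SUP x. \<bar>K t x\<bar>) - s"
      by (rule cSUP_least) (use b(2) in \<open>auto simp: le_diff_eq\<close>)
    moreover have "- (SUP x. \<bar>K t x\<bar>) - s \<le> (INF x. H t x)"
      by (rule cINF_greatest) (use b(1) in \<open>auto simp: diff_le_eq\<close>)
    ultimately show "oscillation H t \<le> 2 * (SUP x. \<bar>K t x\<bar>)" unfolding oscillation_def by linarith
  qed
  then show ?thesis using H1 by auto
qed

lemma half_contact_osc_norm:
  assumes \<psi>: "\<psi> \<in> Cont0 A \<xi> \<pi>"
  shows "1 / 2 * contact_osc_norm A \<xi> \<pi> \<alpha> \<psi> = (INF t. contact_dist A \<xi> \<pi> \<alpha> \<psi> (\<phi> t))"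
proof -
  \<comment> \<open>Indexed by Reeb time: \<open>contact_dist\<close> from \<psi> to \<phi> s is the
    norm of \<open>\<phi> s \<circ> inv \<psi>\<close>.\<close>
  define N where "N s = {integral {0..1} (\<lambda>t. SUP x. \<bar>H t x\<bar>) | H. hamiltonian_path (\<phi> s \<circ> inv \<psi>) H}" for s
  define Osc where "Osc = {integral {0..1} (oscillation H) | H. hamiltonian_path \<psi> H}"
  have bij: "inv (inv \<psi>) = \<psi>" and inv: "inv \<psi> \<in> Cont0 A \<xi> \<pi>"
    using \<psi> Cont0_group by (auto simp: diffeo_group_def diffeo_def inv_inv_eq)
  have dist: "contact_dist A \<xi> \<pi> \<alpha> \<psi> (\<phi> s) = Inf (N s)" for s
    by (simp add: contact_dist_def contact_norm_eq N_def)
  have osc: "contact_osc_norm A \<xi> \<pi> \<alpha> \<psi> = Inf Osc" by (simp add: contact_osc_norm_eq Osc_def)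
  have Osc0: "Osc \<noteq> {}" using ex_hamiltonian_path[OF \<psi>] by (auto simp: Osc_def)
  have Osc_bdd: "bdd_below Osc"
    by (rule bdd_belowI[of _ 0]) (auto simp: Osc_def osc_norm_integral_nonneg)
  have "\<phi> s \<circ> inv \<psi> \<in> Cont0 A \<xi> \<pi>" for s
    using Cont0_group inv flow_in_Cont0 by (auto simp: diffeo_group_def)
  then have N0: "N s \<noteq> {}" for s using ex_hamiltonian_path by (auto simp: N_def)
  have N_nonneg: "0 \<le> n" if "n \<in> N s" for n s
    using that by (auto simp: N_def contact_norm_integral_nonneg)
  have N_bdd: "bdd_below (N s)" for s by (rule bdd_belowI[of _ 0]) (rule N_nonneg)
  \<comment> \<open>The outer infimum over s is one of reals as well and needs its own lower
    bound.\<close>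
  have bdd: "bdd_below (range (\<lambda>s. Inf (N s)))"
    by (rule bdd_belowI[of _ 0]) (auto intro: cInf_greatest[OF N0] N_nonneg)
  have "1 / 2 * Inf Osc = (INF s. Inf (N s))"
  proof (rule antisym)
    show "1 / 2 * Inf Osc \<le> (INF s. Inf (N s))"
    proof (intro cINF_greatest cInf_greatest N0 UNIV_not_empty)
      fix s n assume "n \<in> N s"
      then obtain K where K: "hamiltonian_path (\<phi> s \<circ> inv \<psi>) K"
        "n = integral {0..1} (\<lambda>t. SUP x. \<bar>K t x\<bar>)" by (auto simp: N_def)
      obtain H where H: "hamiltonian_path (inv \<psi>) H" "integral {0..1} (oscillation H) \<le> 2 * n"
        using half_oscillation_le_contact_norm[OF K(1)] K(2) by auto
      \<comment> \<open>The Hamiltonian H leads to \<open>inv \<psi>\<close>; its reversal leads to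
        \<psi> with the same integral, which places that integral in \<open>Osc\<close>.\<close>
      obtain H' where "hamiltonian_path (inv (inv \<psi>)) H'"
        "integral {0..1} (oscillation H') = integral {0..1} (oscillation H)"
        by (rule oscillation_reverse[OF H(1)]) blast
      then have "integral {0..1} (oscillation H) \<in> Osc" unfolding bij Osc_def
        by (intro CollectI exI[of _ H']) simp
      then have "Inf Osc \<le> integral {0..1} (oscillation H)" by (rule cInf_lower[OF _ Osc_bdd])
      with H(2) show "1 / 2 * Inf Osc \<le> n" by simp
    qed
    have "2 * (INF s. Inf (N s)) \<le> Inf Osc"
    proof (rule cInf_greatest[OF Osc0])
      fix x assume "x \<in> Osc"
      then obtain H where H: "hamiltonian_path \<psi> H" "x = integral {0..1} (oscillation H)"
        by (auto simp: Osc_def)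
      obtain H' where H': "hamiltonian_path (inv \<psi>) H'" "integral {0..1} (oscillation H') = x"
        using oscillation_reverse[OF H(1)] H(2) by metis
      \<comment> \<open>The Reeb time found depends on e, but the infimum over all Reeb times does
        not, so e can be sent to 0 afterwards.\<close>
      have "(INF s. Inf (N s)) \<le> x / 2 + e" if e: "0 < e" for e
      proof -
        obtain s K where K: "hamiltonian_path (\<phi> s \<circ> inv \<psi>) K"
          "integral {0..1} (\<lambda>t. SUP x. \<bar>K t x\<bar>) \<le> x / 2 + e"
          using contact_norm_le_half_oscillation[OF H'(1) e] H'(2) by auto
        have "(INF s. Inf (N s)) \<le> Inf (N s)" by (rule cINF_lower[OF bdd]) simp
        also have "\<dots> \<le> integral {0..1} (\<lambda>t. SUP x. \<bar>K t x\<bar>)"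
          by (rule cInf_lower[OF _ N_bdd]) (use K(1) in \<open>auto simp: N_def\<close>)
        finally show ?thesis using K(2) by simp
      qed
      then have "(INF s. Inf (N s)) \<le> x / 2" by (rule field_le_epsilon)
      then show "2 * (INF s. Inf (N s)) \<le> x" by simp
    qed
    then show "(INF s. Inf (N s)) \<le> 1 / 2 * Inf Osc" by simp
  qed
  then show ?thesis by (simp add: osc dist)
qed

end

theorem proposition24:
  fixes A :: "('a::{t2_space,second_countable_topology}, 'e::euclidean_space) chart set"
    and \<xi> \<pi> :: "'a \<Rightarrow> ('a, 'e) tvec set"
    and \<alpha> :: "('a, 'e) oneform"
    and R :: "'a \<Rightarrow> ('a, 'e) tvec"
    and \<phi> :: "real \<Rightarrow> 'a \<Rightarrow> 'a"
    and \<psi> :: "'a \<Rightarrow> 'a"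
  assumes "closed_connected_manifold A"
    and "contact_form_for A \<xi> \<pi> \<alpha>"
    and "reeb_field A \<alpha> R"
    and "flow_of A R \<phi>"
    and "\<psi> \<in> Cont0 A \<xi> \<pi>"
  shows "1 / 2 * contact_osc_norm A \<xi> \<pi> \<alpha> \<psi> = contact_dist_set A \<xi> \<pi> \<alpha> \<psi> (range \<phi>) \<and>
         contact_dist_set A \<xi> \<pi> \<alpha> \<psi> (range \<phi>) = (INF t. contact_dist A \<xi> \<pi> \<alpha> \<psi> (\<phi> t))"
proof -
  interpret closed_contact_reeb A \<alpha> R \<phi> \<xi> \<pi>
    by unfold_locales
      (use assms in \<open>auto simp: closed_connected_manifold_def contact_form_for_def\<close>)
  have "contact_dist_set A \<xi> \<pi> \<alpha> \<psi> (range \<phi>) = (INF t. contact_dist A \<xi> \<pi> \<alpha> \<psi> (\<phi> t))"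
    by (simp add: contact_dist_set_def image_image)
  then show ?thesis using half_contact_osc_norm[OF assms(5)] by simp
qed

end
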